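(* Let $1<q<n-1$, $1\le r\le\infty$, and let $$\omega=\sum_{|J|=n-q}\omega_J\,d\hat{\bar z}_J$$ be a $(0,q)$-form with coefficients in $L^{r}_{c}(\mathbb{D}^n)$ such that $\bar\partial\omega=0$ and such that, for every $J=(j_1,\dots,j_{n-q})$ with $|J|=n-q$ and every $k=1,\dots,n-q$, $$\bar\partial_{j_{n-q}}\cdots\bar\partial_{j_k}\,\omega_J\in L^{r}(\mathbb{C}^n).$$ Then there is a $(0,q-1)$-form $\beta$ with coefficients in $L^{r}_{c}(\mathbb{D}^n)$ such that $\bar\partial\beta=\omega$.
   Context: $\mathbb{D}^n$ is the open unit polydisc in $\mathbb{C}^n$. $L^r_c(\mathbb{D}^n)$ is the space of $L^r$ functions with compact support contained in $\mathbb{D}^n$ (regarded as functions on $\mathbb{C}^n$ by extension by zero). The sum is over multi-indices $J=(j_1<\dots<j_{n-q})$ in $\{1,\dots,n\}$, and $d\hat{\bar z}_J$ is the exterior product, in increasing order, of the $d\bar z_i$ with $i\notin J$. $\bar\partial_j=\partial/\partial\bar z_j$, and all derivatives are in the sense of distributions. *)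

theory Defs
  imports "HOL-Analysis.Analysis"
begin

definition polydisc :: "(complex ^ 'n) set" where
  "polydisc = {z. \<forall>i. norm (z $ i) < 1}"

text \<open>Elements of Lebesgue spaces are represented by functions, not by classes modulo null sets.\<close>

definition Lspace :: "ennreal \<Rightarrow> (complex ^ 'n \<Rightarrow> complex) set" where
  "Lspace r = {f \<in> borel_measurable lebesgue.
     if r = \<infinity> then \<exists>C. AE z in lebesgue. norm (f z) \<le> C
     else (\<integral>\<^sup>+ z. ennreal (norm (f z) powr enn2real r) \<partial>lebesgue) < \<infinity>}"

definition Lspace_c :: "ennreal \<Rightarrow> (complex ^ 'n) set \<Rightarrow> (complex ^ 'n \<Rightarrow> complex) set" where
  "Lspace_c r U = {f \<in> Lspace r.
     \<exists>K. compact K \<and> K \<subseteq> U \<and> (AE z in lebesgue. z \<notin> K \<longrightarrow> f z = 0)}"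

fun Ck :: "nat \<Rightarrow> ('a::euclidean_space \<Rightarrow> 'b::real_normed_vector) \<Rightarrow> bool" where
  "Ck 0 f \<longleftrightarrow> continuous_on UNIV f"
| "Ck (Suc k) f \<longleftrightarrow> (\<forall>x. f differentiable (at x)) \<and>
     (\<forall>v. Ck k (\<lambda>x. frechet_derivative f (at x) v))"

definition test_fun :: "(complex ^ 'n \<Rightarrow> complex) \<Rightarrow> bool" where
  "test_fun \<phi> \<longleftrightarrow> (\<forall>k. Ck k \<phi>) \<and> (\<exists>K. compact K \<and> (\<forall>z. z \<notin> K \<longrightarrow> \<phi> z = 0))"

text \<open>The Wirtinger derivative \<open>(\<partial>/\<partial>x\<^sub>j + \<i> \<partial>/\<partial>y\<^sub>j) / 2\<close>, where \<open>z\<^sub>j = x\<^sub>j + \<i> y\<^sub>j\<close>.\<close>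

definition dbar_fun :: "'n \<Rightarrow> (complex ^ 'n \<Rightarrow> complex) \<Rightarrow> complex ^ 'n \<Rightarrow> complex" where
  "dbar_fun j \<phi> z =
     (frechet_derivative \<phi> (at z) (axis j 1) + \<i> * frechet_derivative \<phi> (at z) (axis j \<i>)) / 2"

text \<open>
  Distributions on \<open>\<complex>\<^sup>n\<close> are represented by functionals of which only the values at test
  functions matter, so they have to be compared by \<open>distr_eq\<close> rather than by \<open>=\<close>.
\<close>

type_synonym 'n distr = "(complex ^ 'n \<Rightarrow> complex) \<Rightarrow> complex"

definition distr_eq :: "'n::finite distr \<Rightarrow> 'n distr \<Rightarrow> bool" where
  "distr_eq S T \<longleftrightarrow> (\<forall>\<phi>. test_fun \<phi> \<longrightarrow> S \<phi> = T \<phi>)"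

definition distr_of :: "(complex ^ 'n \<Rightarrow> complex) \<Rightarrow> 'n::finite distr" where
  "distr_of f = (\<lambda>\<phi>. \<integral>z. f z * \<phi> z \<partial>lebesgue)"

definition dbar_distr :: "'n \<Rightarrow> 'n::finite distr \<Rightarrow> 'n distr" where
  "dbar_distr j T = (\<lambda>\<phi>. - T (dbar_fun j \<phi>))"

definition distr_in_Lspace :: "ennreal \<Rightarrow> 'n::finite distr \<Rightarrow> bool" where
  "distr_in_Lspace r T \<longleftrightarrow> (\<exists>g \<in> Lspace r. distr_eq T (distr_of g))"

text \<open>
  Write \<open>\<epsilon>\<^sub>i\<close> for the differential of the conjugate of \<open>z\<^sub>i\<close>, and \<open>\<epsilon>\<^sub>I\<close> for the exterior product,
  in increasing order, of the \<open>\<epsilon>\<^sub>i\<close> with \<open>i \<in> I\<close>.  A \<open>(0,p)\<close>-form with distribution coefficients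
  is given by the family \<open>F\<close> of its coefficients: \<open>F I\<close> is the coefficient of \<open>\<epsilon>\<^sub>I\<close>, and only the
  sets \<open>I\<close> with \<open>p\<close> elements matter.
\<close>

type_synonym 'n form = "'n set \<Rightarrow> 'n distr"

definition form_eq :: "nat \<Rightarrow> 'n::finite form \<Rightarrow> 'n form \<Rightarrow> bool" where
  "form_eq p F G \<longleftrightarrow> (\<forall>I. card I = p \<longrightarrow> distr_eq (F I) (G I))"

definition zero_form :: "'n::finite form" where
  "zero_form = (\<lambda>I \<phi>. 0)"

text \<open>
  The sign comes from \<open>\<epsilon>\<^sub>j \<and> \<epsilon>\<^bsub>I - {j}\<^esub> = (-1)\<^sup>m \<epsilon>\<^sub>I\<close> for \<open>j \<in> I\<close>, where \<open>m\<close> is the number of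
  elements of \<open>I\<close> below \<open>j\<close>.
\<close>

definition dbar_form :: "'n::{finite,linorder} form \<Rightarrow> 'n form" where
  "dbar_form F = (\<lambda>I \<phi>. \<Sum>j\<in>I. (-1) ^ card {i \<in> I. i < j} * dbar_distr j (F (I - {j})) \<phi>)"

definition form_of :: "('n set \<Rightarrow> complex ^ 'n \<Rightarrow> complex) \<Rightarrow> 'n::finite form" where
  "form_of \<beta> = (\<lambda>I. distr_of (\<beta> I))"

text \<open>
  The form \<open>\<Sum>\<^sub>J \<omega>\<^sub>J \<epsilon>\<^bsub>-J\<^esub>\<close>, whose coefficients are indexed by the complement of the indices
  occurring in the differentials.
\<close>

definition hat_form_of :: "('n set \<Rightarrow> complex ^ 'n \<Rightarrow> complex) \<Rightarrow> 'n::finite form" where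
  "hat_form_of \<omega> = (\<lambda>I. distr_of (\<omega> (- I)))"

end

theory Submission
  imports Defs
begin

text \<open>
  Write \<open>B\<^sub>j\<close> for the Cauchy transform in the variable \<open>z\<^sub>j\<close> and let \<open>\<theta>\<close> be a smooth function of \<open>z\<^sub>j\<close> alone,
  equal to 1 near the supports of the coefficients and vanishing for \<open>|z\<^sub>j|\<close> close to 1.  The operators
  \<open>S u = \<theta> B\<^sub>j u\<close> and \<open>P u = - (\<partial>\<theta>/\<partial>z\<^sub>j-bar) B\<^sub>j u\<close> preserve \<open>L\<^sup>r\<close> functions with compact support in the
  polydisc, commute with the other conjugate derivatives, and satisfy \<open>D S u = u - P u\<close>,
  \<open>S D u = u\<close> and \<open>P D u = 0\<close>, where \<open>D = \<partial>/\<partial>z\<^sub>j-bar\<close>.  Hence, contracting a closed form \<open>\<omega>\<close> with the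
  differential of the conjugate of \<open>z\<^sub>j\<close> and applying \<open>S\<close> gives a form \<open>\<beta>\<close> such that
  \<open>\<omega> - dbar \<beta>\<close> has coefficients \<open>P \<omega>\<^sub>I\<close> for \<open>j \<in> I\<close> and 0 for \<open>j \<notin> I\<close>.  After this has been done for every
  variable only the coefficient with \<open>I\<close> the set of all indices can survive, and there is none in
  degree \<open>q < n\<close>.
\<close>

section \<open>Smooth functions and cutoffs\<close>

text \<open>The coefficients are merely L^r, so no identity between the operators is checked on
  them. Each one is transposed to test functions, where the Cauchy transform becomes
  \<open>cauchy_dual\<close> and classical calculus applies. After transposition the identity is
  needed only at points where a coefficient is nonzero, which is why it suffices that \<theta> = 1
  there and that the kernel is correct for differences of points of the unit disc. The cutoff is
  forced by the support condition: the full Cauchy transform of a compactly supported function in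
  general only decays at infinity, and it has compact support only under moment conditions.
  Multiplying by \<theta> restores the support and creates the error P. The radius containing the
  supports grows with every variable, but there are finitely many variables, so it stays below 1.
  The exponents 1 and \<infinity> need no separate theory, because 1/w is locally integrable in the
  plane: the estimates are those for convolution with an integrable function along a complex line,
  not for singular integrals.\<close>

lemma Ck_imp_continuous_on: "Ck k f \<Longrightarrow> continuous_on UNIV f"
  by (cases k) (auto intro!: differentiable_imp_continuous_on
      simp: differentiable_on_def differentiable_at_withinI)

lemma Ck_SucD: "Ck (Suc k) f \<Longrightarrow> Ck k f"
proof (induction k arbitrary: f)
  case 0
  then show ?case using Ck_imp_continuous_on[OF 0] by simp
next
  case (Suc k)
  have "f differentiable at x" "Ck (Suc k) (\<lambda>x. frechet_derivative f (at x) v)" for x v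
    using Suc.prems by (simp_all only: Ck.simps(2)[of "Suc k" f])
  then show ?case using Suc.IH by simp
qed

text \<open>Uniqueness of the derivative lets an explicit formula replace the chosen
  \<open>frechet_derivative\<close> in the recursion; most closure properties of \<open>Ck\<close>
  are derived through this rule.\<close>

lemma Ck_SucI:
  assumes "\<And>x. (f has_derivative f' x) (at x)" and "\<And>v. Ck k (\<lambda>x. f' x v)"
  shows "Ck (Suc k) f"
proof -
  have "frechet_derivative f (at x) = f' x" for x
    using frechet_derivative_at[OF assms(1)] by simp
  then show ?thesis using assms by (auto simp: differentiable_def)
qed

lemma Ck_Suc_has_derivative:
  "Ck (Suc k) f \<Longrightarrow> (f has_derivative frechet_derivative f (at x)) (at x)"
  by (simp add: frechet_derivative_works)

lemma Ck_const: "Ck k (\<lambda>x. c)"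
proof (induction k arbitrary: c)
  case (Suc k)
  show ?case by (rule Ck_SucI[where f' = "\<lambda>x v. 0"]) (auto simp: Suc)
qed auto

lemma Ck_add: "Ck k f \<Longrightarrow> Ck k g \<Longrightarrow> Ck k (\<lambda>x. f x + g x)"
proof (induction k arbitrary: f g)
  case 0
  then show ?case by (auto intro: continuous_intros)
next
  case (Suc k)
  show ?case
    by (rule Ck_SucI[OF has_derivative_add[OF Ck_Suc_has_derivative Ck_Suc_has_derivative]])
       (use Suc in auto)
qed

lemma Ck_bounded_linear_compose:
  assumes "bounded_linear L"
  shows "Ck k f \<Longrightarrow> Ck k (\<lambda>x. L (f x))"
proof (induction k arbitrary: f)
  case 0
  then show ?case
    using assms by (auto intro: continuous_intros bounded_linear.continuous_on)
next
  case (Suc k)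
  show ?case
    by (rule Ck_SucI[OF bounded_linear.has_derivative[OF assms Ck_Suc_has_derivative]])
       (use Suc in auto)
qed

lemma Ck_bounded_linear:
  assumes "bounded_linear L"
  shows "Ck k L"
proof (cases k)
  case 0
  then show ?thesis
    using assms by (auto intro: linear_continuous_on)
next
  case (Suc m)
  have "Ck (Suc m) L"
    by (rule Ck_SucI[OF bounded_linear_imp_has_derivative[OF assms]]) (rule Ck_const)
  then show ?thesis using Suc by simp
qed

lemma Ck_mult:
  fixes f g :: "'a::euclidean_space \<Rightarrow> 'b::real_normed_algebra"
  shows "Ck k f \<Longrightarrow> Ck k g \<Longrightarrow> Ck k (\<lambda>x. f x * g x)"
proof (induction k arbitrary: f g)
  case 0
  then show ?case by (auto intro: continuous_intros)
next
  case (Suc k)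
  show ?case
  proof (rule Ck_SucI[OF has_derivative_mult[OF Ck_Suc_has_derivative Ck_Suc_has_derivative]])
    fix v
    show "Ck k (\<lambda>x. f x * frechet_derivative g (at x) v + frechet_derivative f (at x) v * g x)"
      using Suc.prems by (intro Ck_add Suc.IH Ck_SucD[of k f] Ck_SucD[of k g]) auto
  qed (use Suc in auto)
qed

text \<open>The derivative is built from the inverse itself and the derivative of \<open>f\<close>,
  so the induction keeps \<open>f\<close> fixed and applies its own hypothesis to the factor
  \<open>inverse (f x)\<close>.\<close>

lemma Ck_inverse:
  fixes f :: "'a::euclidean_space \<Rightarrow> 'b::real_normed_field"
  assumes "\<And>x. f x \<noteq> 0"
  shows "Ck k f \<Longrightarrow> Ck k (\<lambda>x. inverse (f x))"
proof (induction k)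
  case 0
  then show ?case using assms by (auto intro: continuous_intros)
next
  case (Suc k)
  show ?case
  proof (rule Ck_SucI[OF Deriv.has_derivative_inverse[OF assms Ck_Suc_has_derivative]])
    fix v
    have "Ck k (\<lambda>x. (-1) * (inverse (f x) * frechet_derivative f (at x) v * inverse (f x)))"
      using Suc.prems by (intro Ck_mult Ck_const Suc.IH[OF Ck_SucD]) auto
    then show "Ck k (\<lambda>x. - (inverse (f x) * frechet_derivative f (at x) v * inverse (f x)))"
      by simp
  qed (use Suc in auto)
qed

lemma Ck_compose_real:
  fixes h :: "real \<Rightarrow> real"
  shows "Ck k h \<Longrightarrow> Ck k f \<Longrightarrow> Ck k (\<lambda>x. h (f x))"
proof (induction k arbitrary: h)
  case 0
  then show ?case by (auto intro: continuous_on_compose2[where g = h])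
next
  case (Suc k)
  show ?case
  proof (rule Ck_SucI)
    fix x
    show "((\<lambda>x. h (f x)) has_derivative
        (\<lambda>v. frechet_derivative f (at x) v * frechet_derivative h (at (f x)) 1)) (at x)"
    proof -
      \<comment> \<open>A linear map on the reals is multiplication by its value at 1; this turns
        the chain rule into a product of functions, to which \<open>Ck_mult\<close> applies.\<close>
      have *: "frechet_derivative h (at (f x)) t = t * frechet_derivative h (at (f x)) 1" for t
        using linear_cmul[OF has_derivative_linear[OF Ck_Suc_has_derivative[OF Suc.prems(1)]], of "f x" t 1]
        by simp
      have "(\<lambda>v. frechet_derivative f (at x) v * frechet_derivative h (at (f x)) 1) =
          (\<lambda>v. frechet_derivative h (at (f x)) (frechet_derivative f (at x) v))"
        by (intro ext *[symmetric])
      then show ?thesis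
        using has_derivative_compose[OF Ck_Suc_has_derivative[OF Suc.prems(2)]
            Ck_Suc_has_derivative[OF Suc.prems(1)], of x]
        by (simp only:)
    qed
  next
    fix v
    show "Ck k (\<lambda>x. frechet_derivative f (at x) v * frechet_derivative h (at (f x)) 1)"
      using Suc.prems by (intro Ck_mult Suc.IH[of "\<lambda>t. frechet_derivative h (at t) 1"] Ck_SucD[of k f]) auto
  qed
qed

section \<open>Flat functions p(1/t) exp(-1/t) and the cutoff on the real line\<close>

definition flat_exp :: "real poly \<Rightarrow> real \<Rightarrow> real" where
  "flat_exp p t = (if t > 0 then poly p (inverse t) * exp (- inverse t) else 0)"

lemma poly_exp_tendsto_0:
  fixes p :: "real poly"
  shows "((\<lambda>x. poly p x * exp (- x)) \<longlongrightarrow> 0) at_top"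
proof -
  have "((\<lambda>x. \<Sum>i\<le>degree p. coeff p i * (x ^ i / exp x)) \<longlongrightarrow> (\<Sum>i\<le>degree p. coeff p i * 0)) at_top"
    by (intro tendsto_sum tendsto_mult tendsto_const tendsto_power_div_exp_0)
  then show ?thesis
    by (simp add: poly_altdef sum_distrib_right exp_minus divide_inverse mult.assoc)
qed

text \<open>With s = 1/t one has d/dt = -s^2 d/ds, so p(s) exp(-s) becomes s^2 (p - p')(s) exp(-s),
  and \<open>[:0, 0, 1:]\<close> is s^2. The family indexed by polynomials is thus closed under
  differentiation, which is what the induction for smoothness needs.\<close>

lemma flat_exp_has_derivative:
  "(flat_exp p has_real_derivative flat_exp ([:0, 0, 1:] * (p - pderiv p)) t) (at t)"
proof -
  consider "t > 0" | "t < 0" | "t = 0" by linarith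
  then show ?thesis
  proof cases
    case 1
    have "((\<lambda>t. poly p (inverse t) * exp (- inverse t)) has_real_derivative
        flat_exp ([:0, 0, 1:] * (p - pderiv p)) t) (at t)"
    proof -
      have "((\<lambda>x. exp (- inverse x)) has_real_derivative
          exp (- inverse t) * (- (- (inverse t ^ Suc (Suc 0))))) (at t)"
        using 1 by (intro DERIV_chain2[OF DERIV_exp] DERIV_minus DERIV_inverse) auto
      moreover have "((\<lambda>x. poly p (inverse x)) has_real_derivative
          poly (pderiv p) (inverse t) * (- (inverse t ^ Suc (Suc 0)))) (at t)"
        using 1 by (intro DERIV_chain2[OF poly_DERIV] DERIV_inverse) auto
      ultimately show ?thesis
        using 1 by (intro DERIV_cong[OF DERIV_mult]) (auto simp: flat_exp_def algebra_simps)
    qed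
    then show ?thesis
      by (rule has_field_derivative_transform_within_open[where S = "{0<..}"])
         (use 1 in \<open>auto simp: flat_exp_def\<close>)
  next
    case 2
    have "((\<lambda>t. 0) has_real_derivative flat_exp ([:0, 0, 1:] * (p - pderiv p)) t) (at t)"
      using 2 by (auto simp: flat_exp_def)
    then show ?thesis
      by (rule has_field_derivative_transform_within_open[where S = "{..<0}"])
         (use 2 in \<open>auto simp: flat_exp_def\<close>)
  next
    case 3
    \<comment> \<open>For h > 0 the difference quotient at 0 is s p(s) exp(-s) with s = 1/h;
      \<open>[:0, 1:]\<close> supplies the extra factor s.\<close>
    have "((\<lambda>h. poly ([:0, 1:] * p) (inverse h) * exp (- inverse h)) \<longlongrightarrow> 0) (at_right 0)"
      by (rule filterlim_compose[OF poly_exp_tendsto_0 filterlim_inverse_at_top_right])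
    then have right: "((\<lambda>h. flat_exp p h / h) \<longlongrightarrow> 0) (at_right 0)"
      by (rule Lim_transform_eventually)
         (auto simp: flat_exp_def eventually_at_right_less field_simps
            intro!: eventually_mono[OF eventually_at_right_less])
    have left: "((\<lambda>h. flat_exp p h / h) \<longlongrightarrow> 0) (at_left 0)"
      by (rule Lim_transform_eventually[OF tendsto_const])
         (auto simp: flat_exp_def eventually_at_left_field intro!: exI[of _ "-1"])
    show ?thesis
      using filterlim_split_at[OF left right] 3
      by (simp add: DERIV_def flat_exp_def)
  qed
qed

lemma Ck_flat_exp: "Ck k (flat_exp p)"
proof (induction k arbitrary: p)
  case 0
  then show ?case
    using DERIV_isCont[OF flat_exp_has_derivative] by (simp add: continuous_at_imp_continuous_on)
next
  case (Suc k)
  show ?case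
  proof (rule Ck_SucI)
    show "(flat_exp p has_derivative (\<lambda>v. flat_exp ([:0, 0, 1:] * (p - pderiv p)) x * v)) (at x)" for x
      using flat_exp_has_derivative by (simp add: has_field_derivative_def)
  qed (intro Ck_mult Ck_const Suc)
qed

text \<open>The quotient A / (A + B), where A is flat to the right of \<open>b\<close> and B is flat
  to the left of \<open>a\<close>. Since \<open>a < b\<close>, at least one of them is positive at
  every point, so the denominator never vanishes.\<close>

lemma smooth_cutoff_real:
  fixes a b :: real
  assumes "a < b"
  shows "\<exists>h :: real \<Rightarrow> real. (\<forall>k. Ck k h) \<and> (\<forall>t\<le>a. h t = 1) \<and> (\<forall>t\<ge>b. h t = 0)"
proof -
  define D where "D t = flat_exp 1 (b - t) + flat_exp 1 (t - a)" for t
  define h where "h t = flat_exp 1 (b - t) * inverse (D t)" for t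
  have D: "D t \<noteq> 0" for t
  proof -
    have "flat_exp 1 (b - t) \<ge> 0" "flat_exp 1 (t - a) \<ge> 0" by (auto simp: flat_exp_def)
    moreover have "flat_exp 1 (b - t) > 0 \<or> flat_exp 1 (t - a) > 0"
      using assms by (auto simp: flat_exp_def)
    ultimately show ?thesis unfolding D_def by linarith
  qed
  have lin: "Ck k (\<lambda>t::real. b - t)" "Ck k (\<lambda>t::real. t - a)" for k
    using Ck_add[OF Ck_const[of k b] Ck_bounded_linear[OF bounded_linear_minus[OF bounded_linear_ident], of k]]
      Ck_add[OF Ck_const[of k "- a"] Ck_bounded_linear[OF bounded_linear_ident, of k]]
    by simp_all
  have "Ck k D" for k
    unfolding D_def by (intro Ck_add Ck_compose_real[OF Ck_flat_exp] lin)
  then have "Ck k h" for k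
    unfolding h_def
    by (intro Ck_mult Ck_inverse D Ck_compose_real[OF Ck_flat_exp] lin)
  moreover have "h t = 1" if "t \<le> a" for t
  proof -
    have "D t = flat_exp 1 (b - t)" using that by (simp add: D_def flat_exp_def)
    then show ?thesis using D[of t] by (simp add: h_def)
  qed
  moreover have "h t = 0" if "t \<ge> b" for t
    using that by (simp add: h_def flat_exp_def)
  ultimately show ?thesis by blast
qed

section \<open>Differentiation under the integral sign\<close>

lemma frechet_derivative_eq_0_outside:
  fixes f :: "'a::real_normed_vector \<Rightarrow> 'b::real_normed_vector"
  assumes "\<And>x. norm x > R \<Longrightarrow> f x = 0" and "norm x > R"
  shows "frechet_derivative f (at x) = (\<lambda>_. 0)"
proof -
  have "open {x :: 'a. norm x > R}"
    by (intro open_Collect_less continuous_intros)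
  then have "frechet_derivative (\<lambda>x. 0 :: 'b) (at x) = frechet_derivative f (at x)"
    using assms by (intro frechet_derivative_transform_within_open[where X = "{x. norm x > R}"]) auto
  then show ?thesis by simp
qed

lemma bounded_of_support:
  fixes f :: "'a::euclidean_space \<Rightarrow> 'b::real_normed_vector"
  assumes "continuous_on UNIV f" and "\<And>x. norm x > R \<Longrightarrow> f x = 0"
  obtains B where "B \<ge> 0" "\<And>x. norm (f x) \<le> B"
proof -
  have "compact (f ` cball 0 R)"
    using assms(1) by (intro compact_continuous_image) (auto intro: continuous_on_subset)
  then obtain B where B: "\<And>x. x \<in> cball 0 R \<Longrightarrow> norm (f x) \<le> B"
    by (metis bounded_iff compact_imp_bounded image_eqI)
  have "norm (f x) \<le> max B 0" for x
    using B[of x] assms(2)[of x] by (cases "norm x \<le> R") auto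
  then show thesis by (intro that[of "max B 0"]) auto
qed

lemma uniformly_continuous_of_support:
  fixes f :: "'a::euclidean_space \<Rightarrow> 'b::real_normed_vector"
  assumes cont: "continuous_on UNIV f" and supp: "\<And>x. norm x > R \<Longrightarrow> f x = 0" and "e > 0"
  obtains d where "d > 0" "\<And>x y. dist x y < d \<Longrightarrow> dist (f x) (f y) < e"
proof -
  \<comment> \<open>Radius \<open>R + 1\<close> leaves a margin: if two points have distance below 1
    and one of them is outside this ball, then both have norm above \<open>R\<close>, where
    \<open>f\<close> vanishes.\<close>
  have "uniformly_continuous_on (cball 0 (R + 1)) f"
    using cont by (intro compact_uniformly_continuous) (auto intro: continuous_on_subset)
  then obtain d where d: "d > 0"
    "\<And>x y. x \<in> cball 0 (R + 1) \<Longrightarrow> y \<in> cball 0 (R + 1) \<Longrightarrow> dist x y < d \<Longrightarrow> dist (f x) (f y) < e"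
    using \<open>e > 0\<close> unfolding uniformly_continuous_on_def by metis
  have "dist (f x) (f y) < e" if "dist x y < min d 1" for x y
  proof (cases "norm x \<le> R + 1 \<and> norm y \<le> R + 1")
    case True
    then show ?thesis using d that by auto
  next
    case False
    have "\<bar>norm x - norm y\<bar> < 1"
      using norm_triangle_ineq3[of x y] that by (simp add: dist_norm)
    then have "f x = 0" "f y = 0" using False by (auto intro!: supp)
    then show ?thesis using \<open>e > 0\<close> by simp
  qed
  then show thesis using d(1) by (intro that[of "min d 1"]) auto
qed

text \<open>\<open>Ck\<close> gives continuity of the derivative only direction by direction;
  bounding a linear map through its values on a basis turns this into control of the operator
  norm.\<close>

lemma norm_linear_le_Basis:
  fixes L :: "'a::euclidean_space \<Rightarrow> 'b::real_normed_vector"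
  assumes "linear L" and "\<And>b. b \<in> Basis \<Longrightarrow> norm (L b) \<le> B"
  shows "norm (L v) \<le> (real DIM('a) * B) * norm v"
proof -
  have "L (\<Sum>b\<in>Basis. (v \<bullet> b) *\<^sub>R b) = (\<Sum>b\<in>Basis. (v \<bullet> b) *\<^sub>R L b)"
    by (simp add: linear_sum[OF assms(1)] linear_cmul[OF assms(1)])
  then have "norm (L v) = norm (\<Sum>b\<in>Basis. (v \<bullet> b) *\<^sub>R L b)"
    by (simp add: euclidean_representation)
  also have "\<dots> \<le> (\<Sum>b\<in>(Basis::'a set). norm v * B)"
    by (intro sum_norm_le) (auto simp: Basis_le_norm intro!: mult_mono assms)
  finally show ?thesis by (simp add: mult_ac)
qed

text \<open>The support condition makes the derivative uniformly continuous in each basis direction,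
  and the mean value inequality transfers this to \<open>f\<close>. The point is that
  \<open>d\<close> does not depend on \<open>x\<close>.\<close>

lemma Ck_uniformly_differentiable:
  fixes f :: "'a::euclidean_space \<Rightarrow> 'b::real_normed_vector"
  assumes f: "Ck 1 f" and supp: "\<And>x. norm x > R \<Longrightarrow> f x = 0" and "e > 0"
  obtains d where "d > 0"
    "\<And>x v. norm v < d \<Longrightarrow> norm (f (x + v) - f x - frechet_derivative f (at x) v) \<le> e * norm v"
proof -
  let ?D = "\<lambda>x. frechet_derivative f (at x)"
  let ?e = "e / DIM('a)"
  have der: "(f has_derivative ?D x) (at x)" for x
    using f by (simp add: frechet_derivative_works)
  have "\<exists>d>0. \<forall>x y. dist x y < d \<longrightarrow> dist (?D x b) (?D y b) < ?e" for b
    by (rule uniformly_continuous_of_support[of "\<lambda>x. ?D x b" R ?e])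
       (use f \<open>e > 0\<close> frechet_derivative_eq_0_outside[of R f, OF supp] in auto)
  then obtain d where d: "\<And>b. d b > 0"
    "\<And>b x y. dist x y < d b \<Longrightarrow> dist (?D x b) (?D y b) < ?e"
    by metis
  define d0 where "d0 = Min (d ` Basis)"
  have "d0 > 0" using d(1) by (simp add: d0_def)
  moreover have "norm (f (x + v) - f x - ?D x v) \<le> e * norm v" if v: "norm v < d0" for x v
  proof -
    have "norm (f (x + v) - f x - ?D x (x + v - x)) \<le> norm (x + v - x) * e"
    proof (rule differentiable_bound_linearization[where S = "ball x d0"])
      show "x + t *\<^sub>R (x + v - x) \<in> ball x d0" if "t \<in> {0..1}" for t
        using that v mult_left_le_one_le[of "norm v" t] by (simp add: dist_norm)
      show "(f has_derivative ?D y) (at y within ball x d0)" for y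
        by (rule has_derivative_at_withinI[OF der])
      show "onorm (?D y - ?D x) \<le> e" if "y \<in> ball x d0" for y
      proof (rule onorm_bound)
        fix h
        have lin: "linear (\<lambda>h. ?D y h - ?D x h)"
          by (intro linear_compose_sub has_derivative_linear[OF der])
        have "norm (?D y b - ?D x b) \<le> ?e" if b: "b \<in> Basis" for b
        proof -
          have "d0 \<le> d b" using b by (simp add: d0_def)
          then show ?thesis
            using d(2)[of y x b] \<open>y \<in> ball x d0\<close> by (simp add: dist_norm norm_minus_commute)
        qed
        from norm_linear_le_Basis[OF lin this, of h]
        show "norm ((?D y - ?D x) h) \<le> e * norm h" by simp
      qed (use \<open>e > 0\<close> in simp)
      show "x \<in> ball x d0" using \<open>d0 > 0\<close> by simp
    qed
    then show ?thesis by (simp add: mult.commute)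
  qed
  ultimately show thesis by (rule that)
qed

lemma integrable_mult_translate:
  fixes k :: "'c \<Rightarrow> complex" and f :: "'a::euclidean_space \<Rightarrow> complex"
  assumes k: "integrable M k" and \<tau>: "\<tau> \<in> borel_measurable M"
    and f: "continuous_on UNIV f" "\<And>x. norm (f x) \<le> B"
  shows "integrable M (\<lambda>w. k w * f (z + \<tau> w))"
proof (rule Bochner_Integration.integrable_bound)
  show "integrable M (\<lambda>w. B * norm (k w))"
    using k by simp
  have "f \<in> borel_measurable borel"
    using f(1) by (rule borel_measurable_continuous_onI)
  then show "(\<lambda>w. k w * f (z + \<tau> w)) \<in> borel_measurable M"
    using k \<tau> by measurable
  show "AE w in M. norm (k w * f (z + \<tau> w)) \<le> norm (B * norm (k w))"
  proof (intro AE_I2)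
    fix w
    have "norm (k w) * norm (f (z + \<tau> w)) \<le> norm (k w) * \<bar>B\<bar>"
      using f(2)[of "z + \<tau> w"] by (intro mult_left_mono) auto
    then show "norm (k w * f (z + \<tau> w)) \<le> norm (B * norm (k w))"
      by (simp add: norm_mult abs_mult mult.commute)
  qed
qed

text \<open>The linearisation error of \<open>f\<close> is uniform in the base point, so it can be
  integrated against \<open>k\<close> directly. The map \<open>\<tau>\<close> is the identity for
  integrals over the whole space and \<open>axis j\<close> for the Cauchy transform.\<close>

lemma has_derivative_integral_translate:
  fixes k :: "'c \<Rightarrow> complex" and f :: "'a::euclidean_space \<Rightarrow> complex"
  assumes k: "integrable M k" and \<tau>: "\<tau> \<in> borel_measurable M"
    and f: "Ck 1 f" and supp: "\<And>x. norm x > R \<Longrightarrow> f x = 0"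
  shows "((\<lambda>z. \<integral>w. k w * f (z + \<tau> w) \<partial>M) has_derivative
          (\<lambda>v. \<integral>w. k w * frechet_derivative f (at (z + \<tau> w)) v \<partial>M)) (at z)"
    (is "(?F has_derivative ?F') _")
proof -
  let ?D = "\<lambda>x. frechet_derivative f (at x)"
  have der: "(f has_derivative ?D x) (at x)" for x
    using f by (simp add: frechet_derivative_works)
  note lin = has_derivative_linear[OF der]
  obtain B where B: "\<And>x. norm (f x) \<le> B"
    using bounded_of_support[OF Ck_imp_continuous_on[OF f] supp] by metis
  have int_f: "integrable M (\<lambda>w. k w * f (y + \<tau> w))" for y
    by (rule integrable_mult_translate[OF k \<tau> Ck_imp_continuous_on[OF f] B])
  have int_D: "integrable M (\<lambda>w. k w * ?D (y + \<tau> w) v)" for y v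
  proof -
    have cont: "continuous_on UNIV (\<lambda>x. ?D x v)" using f by simp
    obtain B' where "\<And>x. norm (?D x v) \<le> B'"
      using bounded_of_support[OF cont, of R] frechet_derivative_eq_0_outside[of R f, OF supp]
      by metis
    then show ?thesis by (rule integrable_mult_translate[OF k \<tau> cont])
  qed
  have "linear ?F'"
    by (rule linearI)
       (simp_all add: linear_add[OF lin] linear_cmul[OF lin] distrib_left int_D)
  then have "bounded_linear ?F'" by (simp add: linear_conv_bounded_linear)
  moreover have "\<exists>d>0. \<forall>y. norm (y - z) < d \<longrightarrow> norm (?F y - ?F z - ?F' (y - z)) \<le> e * norm (y - z)"
    if "e > 0" for e
  proof -
    define K where "K = (\<integral>w. norm (k w) \<partial>M)"
    have "K \<ge> 0" by (simp add: K_def)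
    \<comment> \<open>The added 1 avoids division by zero when \<open>k\<close> vanishes almost
      everywhere.\<close>
    then have "e / (K + 1) > 0" using \<open>e > 0\<close> by simp
    then obtain d where d: "d > 0"
      "\<And>x v. norm v < d \<Longrightarrow> norm (f (x + v) - f x - ?D x v) \<le> e / (K + 1) * norm v"
      using Ck_uniformly_differentiable[OF f supp] by metis
    have "norm (?F y - ?F z - ?F' (y - z)) \<le> e * norm (y - z)" if y: "norm (y - z) < d" for y
    proof -
      have "?F y - ?F z - ?F' (y - z) =
          (\<integral>w. k w * (f (y + \<tau> w) - f (z + \<tau> w) - ?D (z + \<tau> w) (y - z)) \<partial>M)"
        using int_f int_D by (simp add: right_diff_distrib)
      also have "norm \<dots> \<le> (\<integral>w. norm (k w) * (e / (K + 1) * norm (y - z)) \<partial>M)"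
      proof (rule order.trans[OF integral_norm_bound], rule integral_mono)
        show "integrable M (\<lambda>w. norm (k w * (f (y + \<tau> w) - f (z + \<tau> w) - ?D (z + \<tau> w) (y - z))))"
          using int_f int_D by (simp add: right_diff_distrib)
        show "integrable M (\<lambda>w. norm (k w) * (e / (K + 1) * norm (y - z)))"
          using k by simp
        fix w
        have eq: "z + \<tau> w + (y - z) = y + \<tau> w" by simp
        show "norm (k w * (f (y + \<tau> w) - f (z + \<tau> w) - ?D (z + \<tau> w) (y - z)))
            \<le> norm (k w) * (e / (K + 1) * norm (y - z))"
          using d(2)[OF y, of "z + \<tau> w"] unfolding eq norm_mult by (intro mult_left_mono) auto
      qed
      also have "\<dots> = K / (K + 1) * e * norm (y - z)"
        by (simp add: K_def)
      also have "\<dots> \<le> e * norm (y - z)"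
        using \<open>K \<ge> 0\<close> \<open>e > 0\<close> by (intro mult_right_mono mult_left_le_one_le) auto
      finally show ?thesis .
    qed
    then show ?thesis using d(1) by blast
  qed
  ultimately show ?thesis
    by (auto simp: has_derivative_within_alt)
qed

text \<open>The integral of a translate does not depend on the translation, so its derivative vanishes.\<close>

lemma integral_frechet_derivative_eq_0:
  fixes f :: "'a::euclidean_space \<Rightarrow> complex"
  assumes f: "Ck 1 f" and supp: "\<And>x. norm x > R \<Longrightarrow> f x = 0"
  shows "(\<integral>x. frechet_derivative f (at x) v \<partial>lborel) = 0"
proof -
  \<comment> \<open>The constant 1 is not an integrable kernel, so it is replaced by an indicator.
    With radius \<open>R + 1\<close> it equals 1 on the supports of all translates by less than
    1.\<close>
  define k where "k w = complex_of_real (indicator (cball 0 (R + 1)) w)" for w :: 'a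
  define F where "F z = (\<integral>w. k w * f (z + w) \<partial>lborel)" for z
  have "emeasure lborel (cball (0::'a) (R + 1)) < \<infinity>"
    by (rule emeasure_lborel_cball_finite)
  then have "integrable lborel k"
    unfolding k_def by (intro integrable_of_real integrable_real_indicator) auto
  then have der: "(F has_derivative (\<lambda>v. \<integral>w. k w * frechet_derivative f (at (0 + w)) v \<partial>lborel)) (at 0)"
    unfolding F_def by (rule has_derivative_integral_translate[OF _ _ f supp]) auto
  have "F z = (\<integral>w. f w \<partial>lborel)" if "z \<in> ball 0 1" for z
  proof -
    have "k w * f (z + w) = f (z + w)" for w
    proof (cases "norm w \<le> R + 1")
      case False
      then have "norm (z + w) > R"
        using that norm_diff_ineq[of w z] by (simp add: add.commute)
      then show ?thesis by (simp add: supp)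
    qed (simp add: k_def)
    then have "F z = (\<integral>w. f (z + w) \<partial>lborel)"
      unfolding F_def by presburger
    also have "\<dots> = (\<integral>w. f w \<partial>distr lborel borel ((+) z))"
      using borel_measurable_continuous_onI[OF Ck_imp_continuous_on[OF f]]
      by (subst integral_distr) auto
    finally show ?thesis by (simp add: lborel_distr_plus)
  qed
  then have "(F has_derivative (\<lambda>_. 0)) (at 0)"
    by (intro has_derivative_transform_within_open[OF has_derivative_const open_ball[of 0 1]]) auto
  from has_derivative_unique[OF der this]
  have "(\<integral>w. k w * frechet_derivative f (at (0 + w)) v \<partial>lborel) = 0"
    by meson
  moreover have "k w * frechet_derivative f (at (0 + w)) v = frechet_derivative f (at w) v" for w
    using frechet_derivative_eq_0_outside[of R f, OF supp, of w]
    by (cases "norm w > R") (auto simp: k_def)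
  ultimately show ?thesis by (simp only:)
qed

section \<open>The Cauchy--Pompeiu formula\<close>

text \<open>The sum of \<open>a n\<close> times the indicator of the disc of radius
  \<open>r n\<close> dominates \<open>f\<close>, and the area of that disc is proportional to
  \<open>r n ^ 2\<close>. Dyadic layers thus play the role of polar coordinates.\<close>

lemma integrable_layered:
  fixes f :: "complex \<Rightarrow> complex" and a r :: "nat \<Rightarrow> real"
  assumes meas: "f \<in> borel_measurable borel"
    and le: "\<And>w. f w \<noteq> 0 \<Longrightarrow> \<exists>n. norm w \<le> r n \<and> norm (f w) \<le> a n"
    and nonneg: "\<And>n. a n \<ge> 0" "\<And>n. r n \<ge> 0"
    and summ: "summable (\<lambda>n. a n * r n ^ 2)"
  shows "integrable lborel f"
proof (rule integrableI_bounded)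
  let ?g = "\<lambda>n (w::complex). ennreal (a n) * indicator (cball 0 (r n)) w"
  have le_suminf: "ennreal (norm (f w)) \<le> (\<Sum>n. ?g n w)" for w
  proof (cases "f w = 0")
    case False
    then obtain n where n: "norm w \<le> r n" "norm (f w) \<le> a n" using le by blast
    have "ennreal (norm (f w)) \<le> ?g n w" using n by (simp add: ennreal_leI)
    also have "\<dots> \<le> (\<Sum>n. ?g n w)"
    proof -
      have "F n \<le> suminf F" for F :: "nat \<Rightarrow> ennreal"
        using sum_le_suminf[of F "{n}"] by simp
      then show ?thesis .
    qed
    finally show ?thesis .
  qed simp
  have "(\<integral>\<^sup>+w. norm (f w) \<partial>lborel) \<le> (\<integral>\<^sup>+w. (\<Sum>n. ?g n w) \<partial>lborel)"
    by (rule nn_integral_mono[OF le_suminf])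
  also have "\<dots> = (\<Sum>n. \<integral>\<^sup>+w. ?g n w \<partial>lborel)"
    by (intro nn_integral_suminf borel_measurable_times_ennreal borel_measurable_indicator) auto
  also have "\<dots> = (\<Sum>n. ennreal (a n * (unit_ball_vol 2 * r n ^ 2)))"
    using nonneg by (simp add: nn_integral_cmult_indicator emeasure_cball ennreal_mult)
  also have "\<dots> < \<infinity>"
    using summ nonneg unfolding infinity_ennreal_def less_top[symmetric]
    by (intro ennreal_suminf_neq_top)
       (auto dest: summable_mult[of _ "unit_ball_vol 2"] simp: mult_ac)
  finally show "(\<integral>\<^sup>+w. norm (f w) \<partial>lborel) < \<infinity>" .
qed (use meas in simp)

lemma ex_least_power_gt:
  fixes x b :: real
  assumes "b > 1"
  obtains n where "x \<le> b ^ n" "n = 0 \<or> b ^ (n - 1) < x"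
proof -
  define n where "n = (LEAST n. x \<le> b ^ n)"
  obtain m where "x < b ^ m" using real_arch_pow[OF assms] by blast
  then have "x \<le> b ^ n" unfolding n_def by (rule LeastI[of "\<lambda>n. x \<le> b ^ n", OF less_imp_le])
  moreover have "n = 0 \<or> b ^ (n - 1) < x"
    using not_less_Least[of "n - 1" "\<lambda>n. x \<le> b ^ n"] unfolding n_def[symmetric]
    by (cases n) auto
  ultimately show thesis by (rule that)
qed

text \<open>On the layer where 1/|w| is about 2^n, the point lies in a disc of radius 2 / 2^n, so
  the layer contributes of order 2^n / 4^n. The factor 2 in the radii also covers n = 0, where only
  |w| \<le> 2 is known.\<close>

lemma integrable_inverse_disc:
  "integrable lborel (\<lambda>w::complex. indicator (cball 0 2) w * inverse w)"
proof (rule integrable_layered[where a = "\<lambda>n. 2 ^ n" and r = "\<lambda>n. 2 * (1 / 2) ^ n"])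
  have "(indicator (cball 0 2) :: complex \<Rightarrow> complex) \<in> borel_measurable borel"
    by (intro borel_measurable_indicator) auto
  then show "(\<lambda>w::complex. indicator (cball 0 2) w * inverse w) \<in> borel_measurable borel"
    by measurable
  fix w :: complex
  assume *: "indicator (cball 0 2) w * inverse w \<noteq> 0"
  then have w: "w \<noteq> 0" "norm w \<le> 2" by (auto split: split_indicator_asm)
  obtain n where n: "1 / norm w \<le> 2 ^ n" "n = 0 \<or> 2 ^ (n - 1) < 1 / norm w"
    using ex_least_power_gt[of 2 "1 / norm w"] by auto
  have "norm w \<le> 2 * (1 / 2) ^ n"
  proof (cases n)
    case (Suc m)
    then have "2 ^ m < 1 / norm w" using n by simp
    then have "norm w < 1 / 2 ^ m" using w by (simp add: field_simps)
    then show ?thesis using Suc by (simp add: power_one_over)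
  qed (use w in simp)
  moreover have "norm (indicator (cball 0 2) w * inverse w) \<le> 2 ^ n"
    using n w by (simp add: norm_inverse divide_inverse)
  ultimately show "\<exists>n. norm w \<le> 2 * (1 / 2) ^ n \<and> norm (indicator (cball 0 2) w * inverse w) \<le> 2 ^ n"
    by blast
next
  have "(2::real) ^ n * (2 * (1 / 2) ^ n) ^ 2 = 4 * (1 / 2) ^ n" for n
    by (simp add: power_mult_distrib power2_eq_square power_one_over field_simps)
  then show "summable (\<lambda>n. (2::real) ^ n * (2 * (1 / 2) ^ n) ^ 2)"
    by (simp only:) (simp add: summable_mult summable_geometric)
qed auto

lemma borel_measurable_cnj [measurable]: "cnj \<in> borel_measurable borel"
  by (intro borel_measurable_continuous_onI continuous_intros)

text \<open>This is the spherical area density up to a factor, and the conjugate derivative of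
  \<open>reg_kernel 1\<close>. Writing \<open>w * cnj w\<close> instead of the squared norm lets it
  match the complex expressions produced by differentiation.\<close>

definition bubble :: "complex \<Rightarrow> complex" where
  "bubble w = inverse ((w * cnj w + 1) ^ 2)"

lemma bubble_eq: "bubble w = complex_of_real (inverse ((norm w ^ 2 + 1) ^ 2))"
proof -
  have "w * cnj w + 1 = complex_of_real (norm w ^ 2 + 1)"
    by (simp only: complex_norm_square of_real_add of_real_1)
  then show ?thesis by (simp only: bubble_def of_real_inverse of_real_power)
qed

lemma norm_bubble: "norm (bubble w) = inverse ((norm w ^ 2 + 1) ^ 2)"
  unfolding bubble_eq norm_of_real by simp

lemma integrable_bubble: "integrable lborel bubble"
\<comment> \<open>For |w| > 2^(n-1) the value is at most 16 / 16^n, while the area of the disc grows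
  like 4^n. The factor 16 absorbs the shift of the exponent by one; for n = 0 the bound 1 is
  enough.\<close>
proof (rule integrable_layered[where a = "\<lambda>n. 16 * (1 / 16) ^ n" and r = "\<lambda>n. 2 ^ n"])
  show "bubble \<in> borel_measurable borel"
    unfolding bubble_def by measurable
  fix w :: complex
  obtain n where n: "norm w \<le> 2 ^ n" "n = 0 \<or> 2 ^ (n - 1) < norm w"
    using ex_least_power_gt[of 2 "norm w"] by auto
  have "norm (bubble w) \<le> 16 * (1 / 16) ^ n"
  proof (cases n)
    case 0
    have "inverse ((norm w ^ 2 + 1) ^ 2) \<le> 1"
      by (intro inverse_le_1_iff[THEN iffD2] disjI2) (simp add: one_le_power)
    then show ?thesis using 0 by (simp add: norm_bubble)
  next
    case (Suc m)
    have "(16::real) ^ m = (2 ^ 4) ^ m" by simp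
    also have "\<dots> = ((2 ^ m) ^ 2) ^ 2"
      by (simp only: power_mult[symmetric]) (simp add: mult_ac)
    also have "\<dots> \<le> (norm w ^ 2 + 1) ^ 2"
    proof (intro power_mono)
      have "((2::real) ^ m) ^ 2 \<le> norm w ^ 2" using n Suc by (intro power_mono) auto
      then show "((2::real) ^ m) ^ 2 \<le> norm w ^ 2 + 1" by linarith
    qed auto
    finally have "inverse ((norm w ^ 2 + 1) ^ 2) \<le> inverse (16 ^ m)"
      by (intro le_imp_inverse_le) auto
    then show ?thesis using Suc
      by (simp add: norm_bubble power_one_over inverse_eq_divide)
  qed
  then show "\<exists>n. norm w \<le> 2 ^ n \<and> norm (bubble w) \<le> 16 * (1 / 16) ^ n"
    using n(1) by blast
next
  have "16 * (1 / 16) ^ n * (2 ^ n) ^ 2 = 16 * (1 / 4 :: real) ^ n" for n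
  proof -
    have "((2::real) ^ n) ^ 2 = (2 ^ 2) ^ n" by (simp only: power_mult[symmetric] mult.commute)
    then show ?thesis by (simp add: mult.assoc flip: power_mult_distrib)
  qed
  then show "summable (\<lambda>n. 16 * (1 / 16 :: real) ^ n * (2 ^ n) ^ 2)"
    by (simp only:) (simp add: summable_mult summable_geometric)
qed auto

text \<open>The mass is \<open>\<pi>\<close>, but only the fact that it does not vanish matters.\<close>

definition bubble_mass :: complex where
  "bubble_mass = (\<integral>w. bubble w \<partial>lborel)"

lemma bubble_mass_neq_0: "bubble_mass \<noteq> 0"
proof -
  let ?b = "\<lambda>w::complex. inverse ((norm w ^ 2 + 1) ^ 2)"
  have pos: "?b w > 0" for w
  proof -
    have "norm w ^ 2 + 1 > 0" by (smt (verit) zero_le_power2)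
    then show ?thesis by simp
  qed
  have int: "integrable lborel ?b"
    using integrable_Re[OF integrable_bubble] by (simp add: bubble_eq del: of_real_inverse)
  have "(\<integral>w. ?b w \<partial>lborel) \<noteq> 0"
  proof
    assume "(\<integral>w. ?b w \<partial>lborel) = 0"
    then have "AE w in lborel. ?b w = 0"
      using integral_nonneg_eq_0_iff_AE[OF int] pos less_imp_le by auto
    then have "AE w in (lborel :: complex measure). False"
      by eventually_elim (use pos in \<open>auto simp: less_le\<close>)
    then show False by (simp add: ae_filter_eq_bot_iff flip: trivial_limit_def)
  qed
  then show ?thesis
    by (simp add: bubble_mass_def bubble_eq del: of_real_inverse)
qed

definition dbar1 :: "(complex \<Rightarrow> complex) \<Rightarrow> complex \<Rightarrow> complex" where
  "dbar1 f w = (frechet_derivative f (at w) 1 + \<i> * frechet_derivative f (at w) \<i>) / 2"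

text \<open>A regularisation of 1/w: for \<open>e > 0\<close> it is smooth, its modulus never
  exceeds that of 1/w for w \<noteq> 0, and it tends to 1/w off the origin as \<open>e\<close> tends
  to 0.\<close>

definition reg_kernel :: "real \<Rightarrow> complex \<Rightarrow> complex" where
  "reg_kernel e w = cnj w * inverse (w * cnj w + of_real (e ^ 2))"

lemma reg_denominator_neq_0:
  assumes "e > 0"
  shows "w * cnj w + complex_of_real (e ^ 2) \<noteq> 0"
proof -
  have "w * cnj w + complex_of_real (e ^ 2) = complex_of_real (norm w ^ 2 + e ^ 2)"
    by (simp only: complex_norm_square of_real_add)
  moreover have "norm w ^ 2 + e ^ 2 > 0" using assms by (simp add: add_nonneg_pos)
  ultimately show ?thesis by (metis of_real_eq_0_iff less_irrefl)
qed

lemma Ck_reg_kernel: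
  assumes "e > 0"
  shows "Ck k (reg_kernel e)"
  unfolding reg_kernel_def
  by (intro Ck_mult Ck_inverse Ck_add Ck_const Ck_bounded_linear bounded_linear_cnj bounded_linear_ident
      reg_denominator_neq_0 assms)

lemma reg_kernel_has_derivative:
  assumes "e > 0"
  defines "N \<equiv> \<lambda>w. w * cnj w + complex_of_real (e ^ 2)"
  shows "(reg_kernel e has_derivative
    (\<lambda>v. cnj w * (- (inverse (N w) * (w * cnj v + v * cnj w) * inverse (N w))) + cnj v * inverse (N w))) (at w)"
proof -
  have "(N has_derivative (\<lambda>v. w * cnj v + v * cnj w)) (at w)"
    unfolding N_def by (auto intro!: derivative_eq_intros)
  moreover have "N w \<noteq> 0" unfolding N_def by (rule reg_denominator_neq_0[OF assms(1)])
  ultimately have "((\<lambda>w. inverse (N w)) has_derivative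
      (\<lambda>v. - (inverse (N w) * (w * cnj v + v * cnj w) * inverse (N w)))) (at w)"
    by (intro Deriv.has_derivative_inverse)
  from has_derivative_mult[OF bounded_linear_imp_has_derivative[OF bounded_linear_cnj] this]
  show ?thesis unfolding reg_kernel_def N_def .
qed

text \<open>The quotient rule leaves the numerator \<open>N - w * cnj w\<close>, which is the
  constant e^2. The result is the bubble rescaled by \<open>e\<close> with its mass preserved, that
  is e^-2 times its value at w/e.\<close>

lemma dbar1_reg_kernel:
  assumes "e > 0"
  shows "dbar1 (reg_kernel e) w = of_real (e ^ 2) * inverse ((w * cnj w + of_real (e ^ 2)) ^ 2)"
proof -
  define N where "N = w * cnj w + complex_of_real (e ^ 2)"
  have N: "N \<noteq> 0" using reg_denominator_neq_0[OF assms] by (simp add: N_def)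
  have "dbar1 (reg_kernel e) w = (N - w * cnj w) * inverse (N ^ 2)"
    using N unfolding dbar1_def frechet_derivative_at[OF reg_kernel_has_derivative[OF assms], symmetric] N_def[symmetric]
    by (simp add: field_simps power2_eq_square)
  then show ?thesis by (simp add: N_def)
qed

lemma dbar1_mult:
  assumes "Ck 1 f" "Ck 1 g"
  shows "dbar1 (\<lambda>w. f w * g w) w = f w * dbar1 g w + dbar1 f w * g w"
proof -
  have "((\<lambda>w. f w * g w) has_derivative
      (\<lambda>v. f w * frechet_derivative g (at w) v + frechet_derivative f (at w) v * g w)) (at w)"
    using assms by (intro has_derivative_mult) (auto simp: frechet_derivative_works)
  from frechet_derivative_at[OF this, symmetric] show ?thesis
    by (simp add: dbar1_def field_simps)
qed

text \<open>
  Integrating by parts against the regularised kernels moves the derivative onto them, where it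
  produces the rescalings of the bubble, an approximate identity up to its mass.
\<close>

lemma cauchy_pompeiu:
  assumes f: "Ck 1 f" and supp: "\<And>w. norm w > 2 \<Longrightarrow> f w = 0"
  shows "(\<integral>w. indicator (cball 0 2) w * inverse w * dbar1 f w \<partial>lborel) = - bubble_mass * f 0"
proof -
  have dsupp: "dbar1 f w = 0" if "norm w > 2" for w
    using frechet_derivative_eq_0_outside[of 2 f w, OF supp that] by (simp add: dbar1_def)
  have dcont: "continuous_on UNIV (dbar1 f)"
    using f unfolding dbar1_def by (auto intro!: continuous_intros)
  have fcont: "continuous_on UNIV f" by (rule Ck_imp_continuous_on[OF f])
  obtain B where B: "\<And>w. norm (dbar1 f w) \<le> B"
    using bounded_of_support[OF dcont dsupp] by metis
  obtain B' where B': "B' \<ge> 0" "\<And>w. norm (f w) \<le> B'"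
    using bounded_of_support[OF fcont supp] by metis
  have [measurable]: "f \<in> borel_measurable borel" "dbar1 f \<in> borel_measurable borel"
    using fcont dcont by (auto intro: borel_measurable_continuous_onI)
  have reg_meas [measurable]: "reg_kernel e \<in> borel_measurable borel" for e
    unfolding reg_kernel_def by measurable
  \<comment> \<open>A majorant independent of \<open>e\<close>: it gives integrability for each
    \<open>e\<close> and, at the end, dominated convergence as \<open>e\<close> tends to 0.\<close>
  have reg_le: "norm (reg_kernel e w * dbar1 f w) \<le> B * norm (indicator (cball 0 2) w * inverse w)" for e w
  proof (cases "w = 0 \<or> norm w > 2")
    case True
    then show ?thesis using dsupp[of w] by (auto simp: reg_kernel_def)
  next
    case False
    have "norm (reg_kernel e w) \<le> norm (inverse w)"
    proof -
      have "w * cnj w + complex_of_real (e ^ 2) = complex_of_real (norm w ^ 2 + e ^ 2)"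
        by (simp only: complex_norm_square of_real_add)
      then have "norm (reg_kernel e w) = norm w / (norm w ^ 2 + e ^ 2)"
        by (simp only: reg_kernel_def norm_mult norm_inverse norm_of_real complex_mod_cnj) (simp add: divide_inverse)
      also have "\<dots> \<le> norm w / norm w ^ 2"
        using False by (intro divide_left_mono) (auto intro!: mult_pos_pos add_pos_nonneg)
      also have "norm w / norm w ^ 2 = norm (inverse w)"
        using False by (simp add: power2_eq_square norm_divide field_simps)
      finally show ?thesis .
    qed
    then have "norm (reg_kernel e w) * norm (dbar1 f w) \<le> norm (inverse w) * B"
      using B by (intro mult_mono) auto
    then show ?thesis using False by (simp add: norm_mult mult.commute)
  qed
  have int_bound: "integrable lborel (\<lambda>w. B * norm (indicator (cball 0 2) w * inverse w :: complex))"
    using integrable_inverse_disc by (intro integrable_mult_right integrable_norm)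
  have parts: "(\<integral>w. reg_kernel e w * dbar1 f w \<partial>lborel) = - (\<integral>w. bubble w * f (of_real e * w) \<partial>lborel)"
    if "e > 0" for e
  proof -
    define g where "g w = reg_kernel e w * f w" for w
    have g: "Ck 1 g" unfolding g_def by (intro Ck_mult Ck_reg_kernel that f)
    have gsupp: "g w = 0" if "norm w > 2" for w using supp that by (simp add: g_def)
    have int0: "(\<integral>w. frechet_derivative g (at w) v \<partial>lborel) = 0" for v
      by (rule integral_frechet_derivative_eq_0[OF g gsupp])
    have intg: "integrable lborel (\<lambda>w. frechet_derivative g (at w) v)" for v
    proof -
      have "continuous_on UNIV (\<lambda>w. frechet_derivative g (at w) v)" using g by simp
      then have "integrable lborel (\<lambda>w. indicator (cball 0 2) w *\<^sub>R frechet_derivative g (at w) v)"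
        by (intro borel_integrable_compact) (auto intro: continuous_on_subset)
      moreover have "indicator (cball 0 2) w *\<^sub>R frechet_derivative g (at w) v = frechet_derivative g (at w) v" for w
        using frechet_derivative_eq_0_outside[of 2 g, OF gsupp, of w]
        by (auto split: split_indicator)
      ultimately show ?thesis by (simp only:)
    qed
    \<comment> \<open>Integration by parts without boundary term: \<open>g\<close> is continuously
      differentiable with bounded support, so its directional derivatives have integral 0.\<close>
    have "0 = (\<integral>w. dbar1 g w \<partial>lborel)"
      using intg int0 by (simp add: dbar1_def)
    also have "\<dots> = (\<integral>w. reg_kernel e w * dbar1 f w + dbar1 (reg_kernel e) w * f w \<partial>lborel)"
      using dbar1_mult[OF Ck_reg_kernel[OF that] f] unfolding g_def by simp
    also have "\<dots> = (\<integral>w. reg_kernel e w * dbar1 f w \<partial>lborel) + (\<integral>w. dbar1 (reg_kernel e) w * f w \<partial>lborel)"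
    proof (rule Bochner_Integration.integral_add)
      show int1: "integrable lborel (\<lambda>w. reg_kernel e w * dbar1 f w)"
        by (rule Bochner_Integration.integrable_bound[OF int_bound])
           (auto intro!: AE_I2 order.trans[OF reg_le])
      have "integrable lborel (\<lambda>w. dbar1 g w - reg_kernel e w * dbar1 f w)"
        using intg int1 by (intro Bochner_Integration.integrable_diff) (auto simp: dbar1_def[of g])
      then show "integrable lborel (\<lambda>w. dbar1 (reg_kernel e) w * f w)"
        using dbar1_mult[OF Ck_reg_kernel[OF that] f] unfolding g_def by simp
    qed
    also have "(\<integral>w. dbar1 (reg_kernel e) w * f w \<partial>lborel) = (\<integral>w. bubble w * f (of_real e * w) \<partial>lborel)"
    proof -
      let ?h = "\<lambda>w. dbar1 (reg_kernel e) w * f w"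
      have [measurable]: "?h \<in> borel_measurable borel"
        unfolding dbar1_reg_kernel[OF that] by measurable
      \<comment> \<open>Substitution of e w for w. The Jacobian e^2, from real dimension 2, cancels
        the factor e^-2 of the rescaled bubble and moves the scaling into the argument of
        \<open>f\<close>.\<close>
      have "(\<integral>w. ?h w \<partial>lborel) =
          (\<integral>w. ?h w \<partial>density (distr lborel borel (\<lambda>x. 0 + e *\<^sub>R x)) (\<lambda>_. \<bar>e\<bar>^DIM(complex)))"
        using lborel_affine[of e "0::complex"] that by simp
      also have "\<dots> = (\<integral>w. e ^ 2 *\<^sub>R ?h (of_real e * w) \<partial>lborel)"
        using that by (subst integral_density) (auto simp: integral_distr scaleR_conv_of_real)
      also have "\<dots> = (\<integral>w. bubble w * f (of_real e * w) \<partial>lborel)"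
      proof (rule Bochner_Integration.integral_cong[OF refl])
        fix w
        have "of_real e * w * cnj (of_real e * w) + complex_of_real (e ^ 2) = of_real (e ^ 2) * (w * cnj w + 1)"
          by (simp add: algebra_simps power2_eq_square)
        moreover have "E * (E * inverse ((E * W) ^ 2)) = inverse (W ^ 2)" if "E \<noteq> 0" for E W :: complex
          using that by (cases "W = 0") (auto simp: power2_eq_square field_simps)
        from this[of "of_real (e ^ 2)"]
        have "of_real (e ^ 2) * (of_real (e ^ 2) * inverse ((of_real (e ^ 2) * W) ^ 2)) = inverse (W ^ 2)"
          for W :: complex
          using that by simp
        ultimately show "e ^ 2 *\<^sub>R ?h (of_real e * w) = bubble w * f (of_real e * w)"
          unfolding dbar1_reg_kernel[OF that] bubble_def scaleR_conv_of_real
          by (simp only: mult.assoc[symmetric])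
      qed
      finally show ?thesis .
    qed
    finally show ?thesis by (simp add: eq_neg_iff_add_eq_0)
  qed
  let ?e = "\<lambda>n. inverse (real (Suc n))"
  have e0: "?e \<longlonglongrightarrow> 0" by (rule LIMSEQ_inverse_real_of_nat)
  have "(\<lambda>n. \<integral>w. reg_kernel (?e n) w * dbar1 f w \<partial>lborel)
      \<longlonglongrightarrow> (\<integral>w. indicator (cball 0 2) w * inverse w * dbar1 f w \<partial>lborel)"
  proof (rule integral_dominated_convergence[OF _ _ int_bound])
    show "(\<lambda>w. indicator (cball 0 2) w * inverse w * dbar1 f w) \<in> borel_measurable lborel"
      using borel_measurable_integrable[OF integrable_inverse_disc]
      by (rule borel_measurable_times) simp
    show "AE w in lborel. (\<lambda>n. reg_kernel (?e n) w * dbar1 f w)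
        \<longlonglongrightarrow> indicator (cball 0 2) w * inverse w * dbar1 f w"
    proof (intro AE_I2)
      fix w
      show "(\<lambda>n. reg_kernel (?e n) w * dbar1 f w) \<longlonglongrightarrow> indicator (cball 0 2) w * inverse w * dbar1 f w"
      proof (cases "w = 0 \<or> norm w > 2")
        case True
        then show ?thesis using dsupp[of w] by (auto simp: reg_kernel_def)
      next
        case False
        have "(\<lambda>n. reg_kernel (?e n) w) \<longlonglongrightarrow> cnj w * inverse (w * cnj w + of_real (0 ^ 2))"
          unfolding reg_kernel_def using False
          by (intro tendsto_intros e0) auto
        then have "(\<lambda>n. reg_kernel (?e n) w * dbar1 f w) \<longlonglongrightarrow> inverse w * dbar1 f w"
          using False by (intro tendsto_mult tendsto_const) (simp add: field_simps)
        then show ?thesis using False by simp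
      qed
    qed
  qed (use reg_le in \<open>auto intro!: AE_I2\<close>)
  moreover have "(\<lambda>n. - (\<integral>w. bubble w * f (of_real (?e n) * w) \<partial>lborel)) \<longlonglongrightarrow> - (\<integral>w. bubble w * f 0 \<partial>lborel)"
  proof (rule tendsto_minus, rule integral_dominated_convergence[where w = "\<lambda>w. norm (bubble w) * B'"])
    show "integrable lborel (\<lambda>w. norm (bubble w) * B')" using integrable_bubble by simp
    have [measurable]: "bubble \<in> borel_measurable borel"
      using borel_measurable_integrable[OF integrable_bubble] by simp
    show "(\<lambda>w. bubble w * f 0) \<in> borel_measurable lborel" by simp
    show "(\<lambda>w. bubble w * f (of_real (?e n) * w)) \<in> borel_measurable lborel" for n by simp
    show "AE w in lborel. norm (bubble w * f (of_real (?e n) * w)) \<le> norm (bubble w) * B'" for n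
      using B' by (intro AE_I2) (auto simp: norm_mult intro!: mult_left_mono)
    show "AE w in lborel. (\<lambda>n. bubble w * f (of_real (?e n) * w)) \<longlonglongrightarrow> bubble w * f 0"
    proof (intro AE_I2 tendsto_mult tendsto_const)
      fix w
      have "(\<lambda>n. complex_of_real (?e n) * w) \<longlonglongrightarrow> of_real 0 * w"
        by (intro tendsto_intros e0)
      then have "(\<lambda>n. complex_of_real (?e n) * w) \<longlonglongrightarrow> 0" by simp
      with fcont show "(\<lambda>n. f (of_real (?e n) * w)) \<longlonglongrightarrow> f 0"
        by (rule continuous_on_tendsto_compose) auto
    qed
  qed
  ultimately have "(\<integral>w. indicator (cball 0 2) w * inverse w * dbar1 f w \<partial>lborel) = - (\<integral>w. bubble w * f 0 \<partial>lborel)"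
    using parts by (intro LIMSEQ_unique[of "\<lambda>n. \<integral>w. reg_kernel (?e n) w * dbar1 f w \<partial>lborel"]) auto
  then show ?thesis
    using integrable_bubble by (simp add: bubble_mass_def)
qed

section \<open>The Cauchy transform in one variable\<close>

lemma bounded_linear_axis: "bounded_linear (axis j :: 'a::euclidean_space \<Rightarrow> 'a ^ 'n::finite)"
  by (intro linear_conv_bounded_linear[THEN iffD1] linearI)
     (auto simp: vec_eq_iff axis_def)

lemma borel_measurable_axis [measurable]:
  "(axis j :: 'a::euclidean_space \<Rightarrow> 'a ^ 'n::finite) \<in> borel_measurable borel"
  by (intro borel_measurable_continuous_onI linear_continuous_on bounded_linear_axis)

lemma axis_0: "axis j 0 = 0"
  by (simp add: vec_eq_iff axis_def)

lemma norm_axis: "norm (axis j w :: 'a::euclidean_space ^ 'n::finite) = norm w"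
  by (simp add: norm_eq_sqrt_inner inner_axis_axis)

section \<open>Test functions and their conjugate derivatives\<close>

lemma test_fun_iff_bounded_support:
  fixes \<phi> :: "complex ^ 'n::finite \<Rightarrow> complex"
  shows "test_fun \<phi> \<longleftrightarrow> (\<forall>k. Ck k \<phi>) \<and> (\<exists>R. \<forall>z. norm z > R \<longrightarrow> \<phi> z = 0)"
proof -
  have "(\<exists>K. compact K \<and> (\<forall>z. z \<notin> K \<longrightarrow> \<phi> z = 0)) \<longleftrightarrow> (\<exists>R. \<forall>z. norm z > R \<longrightarrow> \<phi> z = 0)"
    (is "?l \<longleftrightarrow> ?r")
  proof
    assume ?l
    then obtain K where K: "compact K" "\<And>z. z \<notin> K \<Longrightarrow> \<phi> z = 0" by blast
    from compact_imp_bounded[OF K(1)] obtain R where "\<And>z. z \<in> K \<Longrightarrow> norm z \<le> R"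
      by (auto simp: bounded_iff)
    then show ?r using K(2) by (metis not_le)
  next
    assume ?r
    then obtain R where R: "\<And>z. norm z > R \<Longrightarrow> \<phi> z = 0" by blast
    have "compact (cball (0 :: complex ^ 'n) R) \<and> (\<forall>z. z \<notin> cball 0 R \<longrightarrow> \<phi> z = 0)" using R by auto
    then show ?l by blast
  qed
  then show ?thesis by (simp add: test_fun_def)
qed

lemma test_funE:
  assumes "test_fun \<phi>"
  obtains R where "\<And>k. Ck k \<phi>" "\<And>z. norm z > R \<Longrightarrow> \<phi> z = 0"
  using assms unfolding test_fun_iff_bounded_support by blast

lemma test_fun_frechet_derivative:
  assumes "test_fun \<phi>"
  shows "test_fun (\<lambda>z. frechet_derivative \<phi> (at z) v)"
proof -
  obtain R where R: "\<And>k. Ck k \<phi>" "\<And>z. norm z > R \<Longrightarrow> \<phi> z = 0"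
    using test_funE[OF assms] by blast
  have "Ck k (\<lambda>z. frechet_derivative \<phi> (at z) v)" for k
    using R(1)[of "Suc k"] by simp
  moreover have "frechet_derivative \<phi> (at z) v = 0" if "norm z > R" for z
    using frechet_derivative_eq_0_outside[of R \<phi>, OF R(2) that] by simp
  ultimately show ?thesis unfolding test_fun_iff_bounded_support by blast
qed

lemma test_fun_mult:
  assumes "\<And>k. Ck k \<eta>" "test_fun \<phi>"
  shows "test_fun (\<lambda>z. \<eta> z * \<phi> z)"
proof -
  obtain R where R: "\<And>k. Ck k \<phi>" "\<And>z. norm z > R \<Longrightarrow> \<phi> z = 0"
    using test_funE[OF assms(2)] by blast
  have "\<forall>k. Ck k (\<lambda>z. \<eta> z * \<phi> z)" by (intro allI Ck_mult assms(1) R(1))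
  moreover have "\<forall>z. norm z > R \<longrightarrow> \<eta> z * \<phi> z = 0" using R(2) by simp
  ultimately show ?thesis unfolding test_fun_iff_bounded_support by blast
qed

lemma test_fun_add:
  assumes "test_fun \<phi>" "test_fun \<psi>"
  shows "test_fun (\<lambda>z. \<phi> z + \<psi> z)"
proof -
  obtain R where R: "\<And>k. Ck k \<phi>" "\<And>z. norm z > R \<Longrightarrow> \<phi> z = 0"
    using test_funE[OF assms(1)] by blast
  obtain R' where R': "\<And>k. Ck k \<psi>" "\<And>z. norm z > R' \<Longrightarrow> \<psi> z = 0"
    using test_funE[OF assms(2)] by blast
  have "\<phi> z + \<psi> z = 0" if "norm z > max R R'" for z using R(2)[of z] R'(2)[of z] that by simp
  then show ?thesis unfolding test_fun_iff_bounded_support using Ck_add R(1) R'(1) by blast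
qed

lemma Ck_dbar_fun:
  assumes "\<And>k. Ck k \<phi>"
  shows "Ck k (dbar_fun j \<phi>)"
proof -
  have "Ck k (\<lambda>z. frechet_derivative \<phi> (at z) v)" for v using assms[of "Suc k"] by simp
  then have "Ck k (\<lambda>z. (1 / 2) * (frechet_derivative \<phi> (at z) (axis j 1) + \<i> * frechet_derivative \<phi> (at z) (axis j \<i>)))"
    by (intro Ck_mult Ck_add Ck_const)
  then show ?thesis by (simp add: dbar_fun_def[abs_def])
qed

lemma test_fun_dbar_fun:
  assumes "test_fun \<phi>"
  shows "test_fun (dbar_fun j \<phi>)"
proof -
  have "test_fun (\<lambda>z. (1 / 2) * (frechet_derivative \<phi> (at z) (axis j 1) + \<i> * frechet_derivative \<phi> (at z) (axis j \<i>)))"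
    by (intro test_fun_mult test_fun_add Ck_const test_fun_frechet_derivative assms)
  then show ?thesis by (simp add: dbar_fun_def[abs_def])
qed

lemma dbar_fun_mult:
  assumes "\<And>k. Ck k \<eta>" "\<And>k. Ck k \<phi>"
  shows "dbar_fun j (\<lambda>z. \<eta> z * \<phi> z) z = \<eta> z * dbar_fun j \<phi> z + dbar_fun j \<eta> z * \<phi> z"
proof -
  have "((\<lambda>z. \<eta> z * \<phi> z) has_derivative
      (\<lambda>v. \<eta> z * frechet_derivative \<phi> (at z) v + frechet_derivative \<eta> (at z) v * \<phi> z)) (at z)"
    using assms by (intro has_derivative_mult Ck_Suc_has_derivative)
  from frechet_derivative_at[OF this, symmetric] show ?thesis
    by (simp add: dbar_fun_def field_simps)
qed

lemma test_fun_bounded: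
  assumes "test_fun \<phi>"
  obtains B where "\<And>z. norm (\<phi> z) \<le> B"
proof -
  obtain R where R: "\<And>k. Ck k \<phi>" "\<And>z. norm z > R \<Longrightarrow> \<phi> z = 0"
    using test_funE[OF assms] by blast
  show thesis
    by (rule bounded_of_support[OF Ck_imp_continuous_on[OF R(1)] R(2)]) (use that in blast)+
qed

lemma test_fun_continuous: "test_fun \<phi> \<Longrightarrow> continuous_on UNIV \<phi>"
  by (erule test_funE) (rule Ck_imp_continuous_on)

lemma test_fun_measurable: "test_fun \<phi> \<Longrightarrow> \<phi> \<in> borel_measurable borel"
  by (intro borel_measurable_continuous_onI test_fun_continuous)

text \<open>
  The truncation at radius 2, the diameter of the unit disc, makes the kernel integrable without
  affecting the values in the polydisc.
\<close>

definition cauchy_kernel :: "complex \<Rightarrow> complex" where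
  "cauchy_kernel w = inverse bubble_mass * (indicator (cball 0 2) w * inverse w)"

lemma integrable_cauchy_kernel: "integrable lborel cauchy_kernel"
  unfolding cauchy_kernel_def by (intro integrable_mult_right integrable_inverse_disc)

lemma cauchy_kernel_measurable [measurable]: "cauchy_kernel \<in> borel_measurable borel"
  using borel_measurable_integrable[OF integrable_cauchy_kernel] by simp

definition cauchy_op :: "'n::finite \<Rightarrow> (complex ^ 'n \<Rightarrow> complex) \<Rightarrow> complex ^ 'n \<Rightarrow> complex" where
  "cauchy_op j u z = (\<integral>w. cauchy_kernel w * u (z - axis j w) \<partial>lborel)"

text \<open>The transpose of \<open>cauchy_op j\<close> for the bilinear pairing by integration, as
  \<open>cauchy_op_dual\<close> confirms; transposing a convolution reverses the
  translation.\<close>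

definition cauchy_dual :: "'n::finite \<Rightarrow> (complex ^ 'n \<Rightarrow> complex) \<Rightarrow> complex ^ 'n \<Rightarrow> complex" where
  "cauchy_dual j \<phi> z = (\<integral>w. cauchy_kernel w * \<phi> (z + axis j w) \<partial>lborel)"

lemma cauchy_dual_integrable:
  assumes "test_fun \<phi>"
  shows "integrable lborel (\<lambda>w. cauchy_kernel w * \<phi> (z + axis j w))"
proof -
  obtain B where "\<And>z. norm (\<phi> z) \<le> B" using test_fun_bounded[OF assms] by blast
  then show ?thesis
    using integrable_cauchy_kernel test_fun_continuous[OF assms]
    by (intro integrable_mult_translate) auto
qed

lemma cauchy_dual_has_derivative:
  assumes "test_fun \<phi>"
  shows "(cauchy_dual j \<phi> has_derivative (\<lambda>v. cauchy_dual j (\<lambda>z. frechet_derivative \<phi> (at z) v) z)) (at z)"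
proof -
  obtain R where R: "\<And>k. Ck k \<phi>" "\<And>z. norm z > R \<Longrightarrow> \<phi> z = 0"
    using test_funE[OF assms] by blast
  show ?thesis unfolding cauchy_dual_def
    by (rule has_derivative_integral_translate[OF integrable_cauchy_kernel _ R(1) R(2)]) auto
qed

lemma frechet_derivative_cauchy_dual:
  assumes "test_fun \<phi>"
  shows "frechet_derivative (cauchy_dual j \<phi>) (at z) v = cauchy_dual j (\<lambda>z. frechet_derivative \<phi> (at z) v) z"
  using frechet_derivative_at[OF cauchy_dual_has_derivative[OF assms], symmetric] by metis

text \<open>The derivative in a direction is the transform of the derivative of \<phi>, again a test
  function, so the induction has to range over all \<phi>.\<close>

lemma Ck_cauchy_dual: "test_fun \<phi> \<Longrightarrow> Ck k (cauchy_dual j \<phi>)"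
proof (induction k arbitrary: \<phi>)
  case 0
  then show ?case
    by (auto intro!: continuous_at_imp_continuous_on has_derivative_continuous cauchy_dual_has_derivative)
next
  case (Suc k)
  show ?case
    by (rule Ck_SucI[OF cauchy_dual_has_derivative[OF Suc.prems]])
       (intro Suc.IH test_fun_frechet_derivative Suc.prems)
qed

text \<open>Because the kernel vanishes outside the disc of radius 2, the radius of the support
  grows by at most 2; the space of test functions is therefore preserved.\<close>

lemma test_fun_cauchy_dual:
  assumes "test_fun \<phi>"
  shows "test_fun (cauchy_dual j \<phi>)"
proof -
  obtain R where R: "\<And>z. norm z > R \<Longrightarrow> \<phi> z = 0"
    using test_funE[OF assms] by blast
  have "cauchy_dual j \<phi> z = 0" if "norm z > R + 2" for z
  proof -
    have "cauchy_kernel w * \<phi> (z + axis j w) = 0" for w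
    proof (cases "norm w \<le> 2")
      case True
      then have "norm (z + axis j w) > R"
        using that norm_diff_ineq[of z "axis j w"] by (simp add: norm_axis)
      then show ?thesis by (simp add: R)
    qed (simp add: cauchy_kernel_def)
    then show ?thesis by (simp only: cauchy_dual_def integral_zero)
  qed
  then show ?thesis
    unfolding test_fun_iff_bounded_support using Ck_cauchy_dual[OF assms] by blast
qed

lemma cauchy_dual_add:
  assumes "test_fun \<phi>" "test_fun \<psi>"
  shows "cauchy_dual j (\<lambda>z. \<phi> z + \<psi> z) z = cauchy_dual j \<phi> z + cauchy_dual j \<psi> z"
  unfolding cauchy_dual_def distrib_left
  by (intro Bochner_Integration.integral_add cauchy_dual_integrable assms)

lemma cauchy_dual_cmult: "cauchy_dual j (\<lambda>z. c * \<phi> z) z = c * cauchy_dual j \<phi> z"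
  unfolding cauchy_dual_def by (subst integral_mult_right_zero[symmetric]) (simp only: mult_ac)

lemma dbar_cauchy_dual:
  assumes "test_fun \<phi>"
  shows "dbar_fun i (cauchy_dual j \<phi>) z = cauchy_dual j (dbar_fun i \<phi>) z"
proof -
  note t = test_fun_frechet_derivative[OF assms]
  have "cauchy_dual j (\<lambda>z. (1 / 2) * (frechet_derivative \<phi> (at z) (axis i 1) + \<i> * frechet_derivative \<phi> (at z) (axis i \<i>))) z
      = (1 / 2) * (cauchy_dual j (\<lambda>z. frechet_derivative \<phi> (at z) (axis i 1)) z
          + \<i> * cauchy_dual j (\<lambda>z. frechet_derivative \<phi> (at z) (axis i \<i>)) z)"
    by (simp only: cauchy_dual_cmult cauchy_dual_add[OF t test_fun_mult[OF Ck_const t]])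
  then show ?thesis
    by (simp add: dbar_fun_def[abs_def] frechet_derivative_cauchy_dual[OF assms])
qed

text \<open>The Cauchy-Pompeiu formula on the slice through \<open>z\<close> in direction
  \<open>j\<close>. Both \<open>z $ j\<close> and \<open>z $ j + w\<close> lie in the unit disc
  wherever the slice function is nonzero, so |w| < 2 there and the truncation is not felt.\<close>

lemma cauchy_dual_dbar_same:
  assumes \<phi>: "test_fun \<phi>" and supp: "\<And>z. \<phi> z \<noteq> 0 \<Longrightarrow> norm (z $ j) < 1" and z: "norm (z $ j) < 1"
  shows "cauchy_dual j (dbar_fun j \<phi>) z = - \<phi> z"
proof -
  have C: "\<And>k. Ck k \<phi>" using test_funE[OF \<phi>] by blast
  define f where "f w = \<phi> (z + axis j w)" for w
  have der: "(f has_derivative (\<lambda>v. frechet_derivative \<phi> (at (z + axis j w)) (axis j v))) (at w)" for w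
    unfolding f_def
    using bounded_linear_imp_has_derivative[OF bounded_linear_axis[of j]]
    by (intro has_derivative_compose[OF _ Ck_Suc_has_derivative[OF C]])
       (auto intro!: derivative_eq_intros)
  have "Ck 0 (\<lambda>w. frechet_derivative \<phi> (at (z + axis j w)) (axis j v))" for v
  proof -
    have "continuous_on UNIV (\<lambda>z. frechet_derivative \<phi> (at z) (axis j v))"
      using C[of "Suc 0"] by simp
    then show ?thesis
      using continuous_on_compose2[of UNIV "\<lambda>z. frechet_derivative \<phi> (at z) (axis j v)" UNIV "\<lambda>w. z + axis j w"]
        continuous_on_add[OF continuous_on_const linear_continuous_on[OF bounded_linear_axis[of j]], of UNIV z]
      by simp
  qed
  from Ck_SucI[OF der this] have f: "Ck 1 f" by simp
  have fsupp: "f w = 0" if "norm w > 2" for w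
  proof (rule ccontr)
    assume "f w \<noteq> 0"
    then have "norm (z $ j + w) < 1" using supp[of "z + axis j w"] by (simp add: f_def axis_def)
    then show False using that z norm_diff_ineq[of w "z $ j"] by (simp add: add.commute)
  qed
  have "dbar_fun j \<phi> (z + axis j w) = dbar1 f w" for w
    unfolding dbar1_def dbar_fun_def frechet_derivative_at[OF der, symmetric] by simp
  then have "cauchy_dual j (dbar_fun j \<phi>) z =
      inverse bubble_mass * (\<integral>w. indicator (cball 0 2) w * inverse w * dbar1 f w \<partial>lborel)"
    by (simp add: cauchy_dual_def cauchy_kernel_def mult.assoc)
  also have "\<dots> = - f 0"
    using cauchy_pompeiu[OF f fsupp] bubble_mass_neq_0 by simp
  also have "f 0 = \<phi> z"
    by (simp add: f_def axis_0)
  finally show ?thesis .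
qed

section \<open>Functions of a single coordinate and the cutoff in that coordinate\<close>

lemma frechet_derivative_translate:
  "frechet_derivative f (at (a + x)) = frechet_derivative (\<lambda>y. f (a + y)) (at x)"
proof -
  have "(f has_derivative D) (at (a + x)) \<longleftrightarrow> ((\<lambda>y. f (a + y)) has_derivative D) (at x)" for D
    by (auto simp: has_derivative_at add.assoc)
  then show ?thesis by (simp add: frechet_derivative_def)
qed

definition only_coord :: "'n \<Rightarrow> (complex ^ 'n \<Rightarrow> complex) \<Rightarrow> bool" where
  "only_coord j \<eta> \<longleftrightarrow> (\<forall>z z'. z $ j = z' $ j \<longrightarrow> \<eta> z = \<eta> z')"

lemma only_coordD: "only_coord j \<eta> \<Longrightarrow> z $ j = z' $ j \<Longrightarrow> \<eta> z = \<eta> z'"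
  unfolding only_coord_def by blast

text \<open>Points with equal coordinate \<open>j\<close> see the same translate of \<eta>, hence
  the same derivative at the origin of that translate.\<close>

lemma only_coord_dbar_fun:
  assumes "only_coord j \<eta>"
  shows "only_coord j (dbar_fun i \<eta>)"
  unfolding only_coord_def
proof (intro allI impI)
  fix z z' :: "complex ^ 'a"
  assume eq: "z $ j = z' $ j"
  have "(\<lambda>y. \<eta> (z + y)) = (\<lambda>y. \<eta> (z' + y))"
    using assms eq by (intro ext) (simp add: only_coord_def)
  then have "frechet_derivative \<eta> (at (z + 0)) = frechet_derivative \<eta> (at (z' + 0))"
    by (simp only: frechet_derivative_translate)
  then show "dbar_fun i \<eta> z = dbar_fun i \<eta> z'" by (simp add: dbar_fun_def)
qed

text \<open>The restriction of \<eta> to any real line in a direction \<open>axis i v\<close> is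
  constant.\<close>

lemma dbar_fun_only_coord:
  assumes "only_coord j \<eta>" "\<And>k. Ck k \<eta>" "i \<noteq> j"
  shows "dbar_fun i \<eta> z = 0"
proof -
  have "frechet_derivative \<eta> (at z) (axis i v) = 0" for v
  proof -
    have "((\<lambda>t. z + axis i (t *\<^sub>R v)) has_derivative (\<lambda>t. axis i (t *\<^sub>R v))) (at 0)"
      using has_derivative_add[OF has_derivative_const[of z "at 0"] bounded_linear_imp_has_derivative[OF
          bounded_linear_compose[OF bounded_linear_axis[of i] bounded_linear_scaleR_left[of v]]]]
      by simp
    from has_derivative_compose[OF this Ck_Suc_has_derivative[OF assms(2)]]
    have "((\<lambda>t. \<eta> (z + axis i (t *\<^sub>R v))) has_derivative
        (\<lambda>t. frechet_derivative \<eta> (at (z + axis i (0 *\<^sub>R v))) (axis i (t *\<^sub>R v)))) (at (0::real))" .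
    moreover have "(\<lambda>t. \<eta> (z + axis i (t *\<^sub>R v))) = (\<lambda>t. \<eta> z)"
      by (intro ext assms(1)[unfolded only_coord_def, rule_format])
         (use assms(3) in \<open>simp add: axis_def\<close>)
    ultimately have "((\<lambda>t::real. \<eta> z) has_derivative
        (\<lambda>t. frechet_derivative \<eta> (at (z + axis i (0 *\<^sub>R v))) (axis i (t *\<^sub>R v)))) (at 0)"
      by simp
    from has_derivative_unique[OF this has_derivative_const]
    have "frechet_derivative \<eta> (at (z + axis i (0 *\<^sub>R v))) (axis i (1 *\<^sub>R v)) = 0" by meson
    then show ?thesis by (simp add: axis_0)
  qed
  then show ?thesis by (simp add: dbar_fun_def)
qed

lemma cutoff_exists:
  fixes j :: "'n::finite" and \<rho> :: real
  assumes "0 \<le> \<rho>" "\<rho> < 1"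
  obtains \<theta> :: "complex ^ 'n \<Rightarrow> complex" and \<rho>' where
    "\<rho> \<le> \<rho>'" "\<rho>' < 1" "\<And>k. Ck k \<theta>" "only_coord j \<theta>"
    "\<And>z. norm (z $ j) \<le> \<rho> \<Longrightarrow> \<theta> z = 1 \<and> dbar_fun j \<theta> z = 0"
    "\<And>z. norm (z $ j) > \<rho>' \<Longrightarrow> \<theta> z = 0 \<and> dbar_fun j \<theta> z = 0"
proof -
  \<comment> \<open>Two intermediate radii at one and two thirds of the way to 1. Keeping
    \<open>\<rho>1\<close> above \<open>\<rho>\<close> makes the cutoff constant on a neighbourhood
    of the closed disc of radius \<open>\<rho>\<close>, so its derivative vanishes on that whole
    disc.\<close>
  define \<rho>1 where "\<rho>1 = \<rho> + (1 - \<rho>) / 3"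
  define \<rho>2 where "\<rho>2 = \<rho> + 2 * (1 - \<rho>) / 3"
  have \<rho>: "\<rho> < \<rho>1" "\<rho>1 < \<rho>2" "\<rho>2 < 1" "0 < \<rho>1"
    using assms by (auto simp: \<rho>1_def \<rho>2_def field_simps)
  then have lt: "\<rho>1 ^ 2 < \<rho>2 ^ 2" by (intro power_strict_mono) auto
  obtain h :: "real \<Rightarrow> real" where h:
    "\<And>k. Ck k h" "\<And>t. t \<le> \<rho>1 ^ 2 \<Longrightarrow> h t = 1" "\<And>t. t \<ge> \<rho>2 ^ 2 \<Longrightarrow> h t = 0"
    using smooth_cutoff_real[OF lt] by auto
  \<comment> \<open>The squared modulus is a polynomial in the real and imaginary parts, hence
    smooth also at the origin; this is why the one-dimensional cutoff was taken between squared
    radii.\<close>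
  define \<theta> where "\<theta> z = complex_of_real (h (norm (z $ j) ^ 2))" for z :: "complex ^ 'n"
  have re: "bounded_linear (\<lambda>z :: complex ^ 'n. Re (z $ j))" and im: "bounded_linear (\<lambda>z :: complex ^ 'n. Im (z $ j))"
    by (intro bounded_linear_compose[OF bounded_linear_Re] bounded_linear_compose[OF bounded_linear_Im] bounded_linear_vec_nth)+
  have C: "Ck k \<theta>" for k
    unfolding \<theta>_def cmod_power2 unfolding power2_eq_square
    by (intro Ck_bounded_linear_compose[OF bounded_linear_of_real] Ck_compose_real[OF h(1)] Ck_add Ck_mult
        Ck_bounded_linear re im)
  have one: "\<theta> z = 1" if "norm (z $ j) \<le> \<rho>1" for z
    using h(2)[of "norm (z $ j) ^ 2"] power_mono[OF that] by (simp add: \<theta>_def)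
  have zero: "\<theta> z = 0" if "norm (z $ j) \<ge> \<rho>2" for z
    using h(3)[of "norm (z $ j) ^ 2"] power_mono[OF that, of 2] \<rho> by (simp add: \<theta>_def)
  have "dbar_fun j \<theta> z = 0" if "norm (z $ j) \<le> \<rho>" for z
  proof -
    have "open {z :: complex ^ 'n. norm (z $ j) < \<rho>1}"
      by (intro open_Collect_less continuous_intros)
    then have "frechet_derivative (\<lambda>z. 1) (at z) = frechet_derivative \<theta> (at z)"
      using that \<rho> one
      by (intro frechet_derivative_transform_within_open[where X = "{z. norm (z $ j) < \<rho>1}"]) auto
    from this[symmetric] show ?thesis by (simp add: dbar_fun_def)
  qed
  moreover have "dbar_fun j \<theta> z = 0" if "norm (z $ j) > \<rho>2" for z
  proof -
    have "open {z :: complex ^ 'n. norm (z $ j) > \<rho>2}"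
      by (intro open_Collect_less continuous_intros)
    then have "frechet_derivative (\<lambda>z. 0) (at z) = frechet_derivative \<theta> (at z)"
      using that \<rho> zero
      by (intro frechet_derivative_transform_within_open[where X = "{z. norm (z $ j) > \<rho>2}"]) auto
    from this[symmetric] show ?thesis by (simp add: dbar_fun_def)
  qed
  moreover have "only_coord j \<theta>" by (auto simp: only_coord_def \<theta>_def)
  ultimately show thesis
    using \<rho> C one zero by (intro that[of \<rho>2 \<theta>]) auto
qed

text \<open>Transposed, this says that \<eta> B commutes with the conjugate derivative in any other
  variable: \<eta> depends only on coordinate \<open>j\<close>, so the product rule produces no
  extra term.\<close>

lemma dbar_cauchy_dual_mult_other:
  assumes "\<And>k. Ck k \<eta>" "only_coord j \<eta>" "test_fun \<phi>" "i \<noteq> j"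
  shows "dbar_fun i (cauchy_dual j (\<lambda>z. \<eta> z * \<phi> z)) = cauchy_dual j (\<lambda>z. \<eta> z * dbar_fun i \<phi> z)"
proof
  fix z
  have C: "\<And>k. Ck k \<phi>" using test_funE[OF assms(3)] by blast
  have "dbar_fun i (\<lambda>z. \<eta> z * \<phi> z) = (\<lambda>z. \<eta> z * dbar_fun i \<phi> z)"
    using dbar_fun_mult[OF assms(1) C] dbar_fun_only_coord[OF assms(2,1,4)] by (intro ext) simp
  then show "dbar_fun i (cauchy_dual j (\<lambda>z. \<eta> z * \<phi> z)) z = cauchy_dual j (\<lambda>z. \<eta> z * dbar_fun i \<phi> z) z"
    by (simp add: dbar_cauchy_dual test_fun_mult assms)
qed

text \<open>The transpose of \<eta> B D u = \<eta> u. With \<eta> = \<theta> it yields S D u = u,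
  and with \<eta> = -D \<theta> it yields P D u = 0, since on the support of u these factors are 1
  and 0.\<close>

lemma dbar_cauchy_dual_mult_same:
  assumes "\<And>k. Ck k \<eta>" "test_fun \<phi>" "\<And>z. \<eta> z \<noteq> 0 \<Longrightarrow> norm (z $ j) < 1" "norm (z $ j) < 1"
  shows "dbar_fun j (cauchy_dual j (\<lambda>z. \<eta> z * \<phi> z)) z = - (\<eta> z * \<phi> z)"
  using assms by (subst dbar_cauchy_dual) (auto intro!: cauchy_dual_dbar_same test_fun_mult)

text \<open>The transpose of the product rule D (\<eta> B u) = \<eta> u + (D \<eta>) B u; for \<eta>
  = \<theta> this is D S u = u - P u.\<close>

lemma cauchy_dual_mult_dbar:
  assumes "\<And>k. Ck k \<eta>" "test_fun \<phi>" "\<And>z. \<eta> z \<noteq> 0 \<Longrightarrow> norm (z $ j) < 1" "norm (z $ j) < 1"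
  shows "cauchy_dual j (\<lambda>z. \<eta> z * dbar_fun j \<phi> z) z
    = - (\<eta> z * \<phi> z) - cauchy_dual j (\<lambda>z. dbar_fun j \<eta> z * \<phi> z) z"
proof -
  have C: "\<And>k. Ck k \<phi>" using test_funE[OF assms(2)] by blast
  have "dbar_fun j (\<lambda>z. \<eta> z * \<phi> z) = (\<lambda>z. \<eta> z * dbar_fun j \<phi> z + dbar_fun j \<eta> z * \<phi> z)"
    using dbar_fun_mult[OF assms(1) C] by (intro ext)
  then have "cauchy_dual j (dbar_fun j (\<lambda>z. \<eta> z * \<phi> z)) z =
      cauchy_dual j (\<lambda>z. \<eta> z * dbar_fun j \<phi> z) z + cauchy_dual j (\<lambda>z. dbar_fun j \<eta> z * \<phi> z) z"
    by (simp add: cauchy_dual_add test_fun_mult test_fun_dbar_fun Ck_dbar_fun assms)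
  moreover have "cauchy_dual j (dbar_fun j (\<lambda>z. \<eta> z * \<phi> z)) z = - (\<eta> z * \<phi> z)"
    using assms by (intro cauchy_dual_dbar_same test_fun_mult) auto
  ultimately show ?thesis by (simp add: algebra_simps)
qed

section \<open>Boundedness on Lebesgue spaces\<close>

text \<open>
  Borel representatives for which the support condition, and the bound if \<open>r = \<infinity>\<close>, hold everywhere
  and not just almost everywhere.
\<close>

definition reg_Lp :: "ennreal \<Rightarrow> real \<Rightarrow> (complex ^ 'n::finite \<Rightarrow> complex) set" where
  "reg_Lp r \<rho> = {u \<in> borel_measurable borel.
     (if r = \<infinity> then \<exists>C. \<forall>z. norm (u z) \<le> C
      else (\<integral>\<^sup>+ z. ennreal (norm (u z) powr enn2real r) \<partial>lborel) < \<infinity>) \<and>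
     (\<forall>z. u z \<noteq> 0 \<longrightarrow> (\<forall>i. norm (z $ i) \<le> \<rho>))}"

lemma reg_LpD:
  assumes "u \<in> reg_Lp r \<rho>"
  shows "u \<in> borel_measurable borel" and "u z \<noteq> 0 \<Longrightarrow> norm (z $ i) \<le> \<rho>"
    and "r \<noteq> \<infinity> \<Longrightarrow> (\<integral>\<^sup>+ z. ennreal (norm (u z) powr enn2real r) \<partial>lborel) < \<infinity>"
  using assms by (auto simp: reg_Lp_def)

lemma reg_Lp_topE:
  assumes "u \<in> reg_Lp \<infinity> \<rho>"
  obtains C where "C \<ge> 0" "\<And>z. norm (u z) \<le> C"
proof -
  obtain C where C: "\<And>z. norm (u z) \<le> C" using assms by (auto simp: reg_Lp_def)
  moreover have "C \<ge> 0" using C[of 0] norm_ge_zero order.trans by blast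
  ultimately show thesis using that by blast
qed

lemma reg_Lp_mono:
  assumes "u \<in> reg_Lp r \<rho>" "\<rho> \<le> \<rho>'"
  shows "u \<in> reg_Lp r \<rho>'"
proof -
  have "norm (z $ i) \<le> \<rho>'" if "u z \<noteq> 0" for z i
    using reg_LpD(2)[OF assms(1) that, of i] assms(2) by linarith
  then show ?thesis using assms(1) by (auto simp: reg_Lp_def)
qed

lemma reg_Lp_zero: "(\<lambda>_. 0) \<in> reg_Lp r \<rho>"
  by (auto simp: reg_Lp_def)

lemma one_le_enn2real:
  assumes "1 \<le> r" "r \<noteq> \<infinity>"
  shows "1 \<le> enn2real r"
  using assms by (cases r) (auto simp: top_ennreal_def simp flip: ennreal_1)

text \<open>Bounding the sum by twice the maximum is crude, but only finiteness of integrals is at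
  stake.\<close>

lemma norm_add_powr_le:
  fixes a b :: "'a::real_normed_vector"
  assumes "p \<ge> 0"
  shows "norm (a + b) powr p \<le> 2 powr p * (norm a powr p + norm b powr p)"
proof -
  have "norm (a + b) \<le> 2 * max (norm a) (norm b)"
    using norm_triangle_ineq[of a b] by linarith
  then have "norm (a + b) powr p \<le> (2 * max (norm a) (norm b)) powr p"
    using assms by (intro powr_mono2) auto
  also have "\<dots> = 2 powr p * max (norm a) (norm b) powr p"
    by (rule powr_mult)
  also have "\<dots> \<le> 2 powr p * (norm a powr p + norm b powr p)"
    by (intro mult_left_mono) (auto simp: max_def)
  finally show ?thesis .
qed

lemma reg_Lp_add:
  assumes u: "u \<in> reg_Lp r \<rho>" and v: "v \<in> reg_Lp r \<rho>"
  shows "(\<lambda>z. u z + v z) \<in> reg_Lp r \<rho>"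
proof -
  note [measurable] = reg_LpD(1)[OF u] reg_LpD(1)[OF v]
  have supp: "norm (z $ i) \<le> \<rho>" if "u z + v z \<noteq> 0" for z i
  proof -
    have "u z \<noteq> 0 \<or> v z \<noteq> 0" using that by auto
    then show ?thesis using reg_LpD(2)[OF u] reg_LpD(2)[OF v] by blast
  qed
  have meas: "(\<lambda>z. u z + v z) \<in> borel_measurable borel" by measurable
  show ?thesis
  proof (cases "r = \<infinity>")
    case True
    obtain C D where "\<And>z. norm (u z) \<le> C" "\<And>z. norm (v z) \<le> D"
      using u v unfolding True by (metis reg_Lp_topE)
    then have "norm (u z + v z) \<le> C + D" for z by (rule norm_triangle_mono)
    then show ?thesis using True supp meas by (auto simp: reg_Lp_def)
  next
    case False
    define p where "p = enn2real r"
    have "(\<integral>\<^sup>+z. ennreal (norm (u z + v z) powr p) \<partial>lborel)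
        \<le> (\<integral>\<^sup>+z. ennreal (2 powr p) * (ennreal (norm (u z) powr p) + ennreal (norm (v z) powr p)) \<partial>lborel)"
    proof (rule nn_integral_mono)
      fix z
      have "norm (u z + v z) powr p \<le> 2 powr p * (norm (u z) powr p + norm (v z) powr p)"
        by (rule norm_add_powr_le) (simp add: p_def)
      then show "ennreal (norm (u z + v z) powr p)
          \<le> ennreal (2 powr p) * (ennreal (norm (u z) powr p) + ennreal (norm (v z) powr p))"
        by (simp add: ennreal_leI flip: ennreal_mult ennreal_plus)
    qed
    also have "\<dots> = ennreal (2 powr p) * ((\<integral>\<^sup>+z. ennreal (norm (u z) powr p) \<partial>lborel) + (\<integral>\<^sup>+z. ennreal (norm (v z) powr p) \<partial>lborel))"
      by (simp add: nn_integral_cmult nn_integral_add)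
    also have "\<dots> < \<infinity>"
      using reg_LpD(3)[OF u False] reg_LpD(3)[OF v False] by (simp add: p_def ennreal_mult_less_top)
    finally show ?thesis using False supp meas by (auto simp: reg_Lp_def p_def)
  qed
qed

lemma norm_vec_le_of_components:
  fixes z :: "complex ^ 'n::finite"
  assumes "\<And>i. norm (z $ i) \<le> \<rho>"
  shows "norm z \<le> real CARD('n) * \<rho>"
proof -
  have "norm z \<le> (\<Sum>i\<in>UNIV. norm (z $ i))"
    unfolding norm_vec_def by (rule L2_set_le_sum) simp
  also have "\<dots> \<le> real CARD('n) * \<rho>"
    using assms sum_bounded_above[of UNIV "\<lambda>i. norm (z $ i)" \<rho>] by simp
  finally show ?thesis .
qed

text \<open>The support lies in a ball \<open>B\<close> of finite measure, and |u| is at most the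
  indicator of \<open>B\<close> plus |u|^p. Integrability is what pairings with bounded test
  functions and Fubini require.\<close>

lemma reg_Lp_integrable:
  fixes u :: "complex ^ 'n::finite \<Rightarrow> complex"
  assumes u: "u \<in> reg_Lp r \<rho>" and r: "1 \<le> r"
  shows "integrable lborel u"
proof (rule integrableI_bounded)
  note [measurable] = reg_LpD(1)[OF u]
  show "u \<in> borel_measurable lborel" by simp
  define B where "B = cball (0 :: complex ^ 'n) (real CARD('n) * \<rho>)"
  have [measurable]: "B \<in> sets borel" by (simp add: B_def)
  have fin: "emeasure lborel B < \<infinity>" unfolding B_def by (rule emeasure_lborel_cball_finite)
  have B: "z \<in> B" if "u z \<noteq> 0" for z
    using norm_vec_le_of_components[of z \<rho>, OF reg_LpD(2)[OF u that]] by (simp add: B_def)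
  show "(\<integral>\<^sup>+z. norm (u z) \<partial>lborel) < \<infinity>"
  proof (cases "r = \<infinity>")
    case True
    obtain C where C: "C \<ge> 0" "\<And>z. norm (u z) \<le> C" using u unfolding True by (metis reg_Lp_topE)
    have "(\<integral>\<^sup>+z. norm (u z) \<partial>lborel) \<le> (\<integral>\<^sup>+z. ennreal C * indicator B z \<partial>lborel)"
      using C B by (intro nn_integral_mono) (auto split: split_indicator simp: ennreal_leI)
    also have "\<dots> < \<infinity>"
      using fin by (simp add: nn_integral_cmult_indicator ennreal_mult_less_top)
    finally show ?thesis .
  next
    case False
    define p where "p = enn2real r"
    have p: "p \<ge> 1" using one_le_enn2real[OF r False] by (simp add: p_def)
    have "(\<integral>\<^sup>+z. norm (u z) \<partial>lborel) \<le> (\<integral>\<^sup>+z. indicator B z + ennreal (norm (u z) powr p) \<partial>lborel)"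
    proof (rule nn_integral_mono)
      fix z
      show "ennreal (norm (u z)) \<le> indicator B z + ennreal (norm (u z) powr p)"
      proof (cases "norm (u z) \<le> 1")
        case True
        show ?thesis
        proof (cases "u z = 0")
          case False
          then have "ennreal (norm (u z)) \<le> indicator B z"
            using True B by (simp add: ennreal_le_1)
          then show ?thesis by (rule order.trans) simp
        qed simp
      next
        case False
        then have "norm (u z) powr 1 \<le> norm (u z) powr p" using p by (intro powr_mono) auto
        then have "ennreal (norm (u z)) \<le> ennreal (norm (u z) powr p)" by (intro ennreal_leI) simp
        then show ?thesis by (simp add: add_increasing)
      qed
    qed
    also have "\<dots> = emeasure lborel B + (\<integral>\<^sup>+z. ennreal (norm (u z) powr p) \<partial>lborel)"
      by (subst nn_integral_add) auto
    also have "\<dots> < \<infinity>"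
      using fin reg_LpD(3)[OF u False] by (simp add: p_def)
    finally show ?thesis .
  qed
qed

text \<open>The graph of the convex function t^p lies above its tangent at \<open>m\<close>; the
  inequality is the tangent bound rearranged.\<close>

lemma young_tangent:
  fixes t m p :: real
  assumes "t \<ge> 0" "m > 0" "p \<ge> 1"
  shows "p * m powr (p - 1) * t \<le> t powr p + (p - 1) * m powr p"
proof (cases "t = 0")
  case True
  then show ?thesis using assms by simp
next
  case False
  then have "(t powr p) powr (1 / p) * (m powr p) powr (1 - 1 / p) \<le> 1 / p * t powr p + (1 - 1 / p) * m powr p"
    using assms by (intro Youngs_inequality_0) auto
  moreover have "p * (1 - 1 / p) = p - 1" using assms by (simp add: field_simps)
  then have "(m powr p) powr (1 - 1 / p) = m powr (p - 1)" by (simp add: powr_powr)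
  ultimately have "t * m powr (p - 1) \<le> 1 / p * t powr p + (1 - 1 / p) * m powr p"
    using assms False by (simp add: powr_powr)
  then have "p * (t * m powr (p - 1)) \<le> p * (1 / p * t powr p + (1 - 1 / p) * m powr p)"
    using assms by (intro mult_left_mono) auto
  also have "\<dots> = t powr p + (p - 1) * m powr p"
    using assms by (simp add: field_simps)
  finally show ?thesis by (simp add: mult_ac)
qed

text \<open>Jensen's inequality for the probability density |k|/K, obtained by integrating the
  tangent bound of \<open>young_tangent\<close> against |k|.\<close>

lemma norm_integral_powr_le:
  fixes k u :: "'a \<Rightarrow> complex"
  assumes k: "integrable M k" and u [measurable]: "u \<in> borel_measurable M" and p: "p \<ge> 1"
  defines "K \<equiv> \<integral>w. norm (k w) \<partial>M"
  shows "ennreal (norm (\<integral>w. k w * u w \<partial>M) powr p)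
    \<le> ennreal (K powr (p - 1)) * (\<integral>\<^sup>+w. ennreal (norm (k w) * norm (u w) powr p) \<partial>M)"
\<comment> \<open>The zero case includes products that are not integrable, whose integral is 0 by
  convention; in the other case integrability follows.\<close>
proof (cases "(\<integral>w. k w * u w \<partial>M) = 0")
  case False
  note [measurable] = borel_measurable_integrable[OF k]
  define x where "x = norm (\<integral>w. k w * u w \<partial>M)"
  have x: "x > 0" using False by (simp add: x_def)
  have int: "integrable M (\<lambda>w. k w * u w)" using False not_integrable_integral_eq by blast
  have K: "K > 0"
  proof -
    have "K \<noteq> 0"
    proof
      assume "K = 0"
      then have "AE w in M. norm (k w) = 0"
        using integral_nonneg_eq_0_iff_AE[of M "\<lambda>w. norm (k w)"] k by (simp add: K_def)
      then have "(\<integral>w. k w * u w \<partial>M) = (\<integral>w. 0 \<partial>M)" by (intro integral_cong_AE) auto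
      then show False using False by simp
    qed
    moreover have "K \<ge> 0" by (simp add: K_def)
    ultimately show ?thesis by simp
  qed
  show ?thesis
  proof (cases "(\<integral>\<^sup>+w. ennreal (norm (k w) * norm (u w) powr p) \<partial>M) = \<infinity>")
    case True
    then show ?thesis using K by (simp add: ennreal_mult_top)
  next
    case fin: False
    \<comment> \<open>The tangent is taken at this normalised value because then m^(p-1) x = m^p K,
      and the inequality collapses to m^p K \<le> G.\<close>
    define m where "m = x / K"
    have m: "m > 0" using x K by (simp add: m_def)
    define G where "G = (\<integral>w. norm (k w) * norm (u w) powr p \<partial>M)"
    have intG: "integrable M (\<lambda>w. norm (k w) * norm (u w) powr p)"
      using fin by (intro integrableI_nonneg) (auto simp: less_top)
    have "x \<le> (\<integral>w. norm (k w) * norm (u w) \<partial>M)"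
      using integral_norm_bound[of M "\<lambda>w. k w * u w"] by (simp add: x_def norm_mult)
    then have "p * m powr (p - 1) * x \<le> p * m powr (p - 1) * (\<integral>w. norm (k w) * norm (u w) \<partial>M)"
      using p by (intro mult_left_mono) auto
    also have "\<dots> = (\<integral>w. p * m powr (p - 1) * (norm (k w) * norm (u w)) \<partial>M)" by simp
    also have "\<dots> \<le> (\<integral>w. norm (k w) * norm (u w) powr p + (p - 1) * m powr p * norm (k w) \<partial>M)"
    proof (rule integral_mono)
      show "integrable M (\<lambda>w. p * m powr (p - 1) * (norm (k w) * norm (u w)))"
        using integrable_norm[OF int] by (intro integrable_mult_right) (simp add: norm_mult)
      show "integrable M (\<lambda>w. norm (k w) * norm (u w) powr p + (p - 1) * m powr p * norm (k w))"
        using intG k by (intro Bochner_Integration.integrable_add integrable_mult_right integrable_norm)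
      fix w
      have "norm (k w) * (p * m powr (p - 1) * norm (u w)) \<le> norm (k w) * (norm (u w) powr p + (p - 1) * m powr p)"
        using young_tangent[OF _ m p] by (intro mult_left_mono) auto
      then show "p * m powr (p - 1) * (norm (k w) * norm (u w))
          \<le> norm (k w) * norm (u w) powr p + (p - 1) * m powr p * norm (k w)"
        by (simp add: algebra_simps)
    qed
    also have "\<dots> = G + (p - 1) * m powr p * K"
      using intG k by (simp add: G_def K_def)
    finally have "p * m powr (p - 1) * x \<le> G + (p - 1) * m powr p * K" .
    moreover have "m powr (p - 1) * x = m powr p * K"
    proof -
      have "m powr p = m powr (p - 1) * m" using m powr_add[of m "p - 1" 1] by simp
      then show ?thesis using K by (simp add: m_def)
    qed
    ultimately have le: "m powr p * K \<le> G" by (simp add: algebra_simps)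
    have "x powr p = (K * m) powr p" using K by (simp add: m_def)
    also have "\<dots> = K powr p * m powr p" using K m by (simp add: powr_mult)
    also have "K powr p = K powr (p - 1) * K" using K powr_add[of K "p - 1" 1] by simp
    also have "K powr (p - 1) * K * m powr p \<le> K powr (p - 1) * G"
      using mult_left_mono[OF le, of "K powr (p - 1)"] by (simp add: mult_ac)
    finally have "ennreal (x powr p) \<le> ennreal (K powr (p - 1)) * ennreal G"
      by (simp add: ennreal_leI G_def flip: ennreal_mult)
    also have "ennreal G = (\<integral>\<^sup>+w. ennreal (norm (k w) * norm (u w) powr p) \<partial>M)"
      unfolding G_def by (rule nn_integral_eq_integral[symmetric, OF intG]) simp
    finally show ?thesis by (simp add: x_def)
  qed
qed simp

lemma nn_integral_translate:
  fixes f :: "'a::euclidean_space \<Rightarrow> ennreal"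
  assumes "f \<in> borel_measurable borel"
  shows "(\<integral>\<^sup>+z. f (z + a) \<partial>lborel) = (\<integral>\<^sup>+z. f z \<partial>lborel)"
proof -
  have "(\<integral>\<^sup>+z. f z \<partial>lborel) = (\<integral>\<^sup>+z. f z \<partial>distr lborel borel ((+) a))" by (simp add: lborel_distr_plus)
  also have "\<dots> = (\<integral>\<^sup>+z. f (z + a) \<partial>lborel)"
    using assms by (subst nn_integral_distr) (auto simp: add.commute)
  finally show ?thesis by simp
qed

lemma cauchy_op_measurable:
  assumes [measurable]: "u \<in> borel_measurable borel"
  shows "cauchy_op j u \<in> borel_measurable borel"
  unfolding cauchy_op_def by measurable

lemma cauchy_op_bounded:
  assumes u: "u \<in> borel_measurable borel" and C: "\<And>z. norm (u z) \<le> C"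
  shows "norm (cauchy_op j u z) \<le> (\<integral>w. norm (cauchy_kernel w) \<partial>lborel) * C"
proof -
  have "norm (cauchy_op j u z) \<le> (\<integral>w. norm (cauchy_kernel w * u (z - axis j w)) \<partial>lborel)"
    unfolding cauchy_op_def by (rule integral_norm_bound)
  also have "\<dots> \<le> (\<integral>w. norm (cauchy_kernel w) * C \<partial>lborel)"
  proof (rule integral_mono_AE')
    show "integrable lborel (\<lambda>w. norm (cauchy_kernel w) * C)"
      using integrable_cauchy_kernel by simp
    show "AE w in lborel. norm (cauchy_kernel w * u (z - axis j w)) \<le> norm (cauchy_kernel w) * C"
      using C by (auto simp: norm_mult intro!: mult_left_mono)
    have "C \<ge> 0" using C[of 0] norm_ge_zero order.trans by blast
    then show "AE w in lborel. 0 \<le> norm (cauchy_kernel w) * C" by simp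
  qed
  finally show ?thesis by simp
qed

text \<open>Convolution with an integrable kernel preserves L^p: Jensen's inequality in
  \<open>w\<close>, then Tonelli, then translation invariance of the inner integral over the whole
  space.\<close>

lemma nn_integral_cauchy_op_powr:
  assumes u [measurable]: "u \<in> borel_measurable borel" and p: "p \<ge> 1"
    and fin: "(\<integral>\<^sup>+z. ennreal (norm (u z) powr p) \<partial>lborel) < \<infinity>"
  shows "(\<integral>\<^sup>+z. ennreal (norm (cauchy_op j u z) powr p) \<partial>lborel) < \<infinity>"
proof -
  let ?K = "\<integral>w. norm (cauchy_kernel w) \<partial>lborel"
  have "(\<integral>\<^sup>+z. ennreal (norm (cauchy_op j u z) powr p) \<partial>lborel)
      \<le> (\<integral>\<^sup>+z. ennreal (?K powr (p - 1)) *
          (\<integral>\<^sup>+w. ennreal (norm (cauchy_kernel w) * norm (u (z - axis j w)) powr p) \<partial>lborel) \<partial>lborel)"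
    unfolding cauchy_op_def
    by (intro nn_integral_mono norm_integral_powr_le integrable_cauchy_kernel p) auto
  also have "\<dots> = ennreal (?K powr (p - 1)) *
      (\<integral>\<^sup>+z. (\<integral>\<^sup>+w. ennreal (norm (cauchy_kernel w) * norm (u (z - axis j w)) powr p) \<partial>lborel) \<partial>lborel)"
    by (rule nn_integral_cmult) measurable
  also have "(\<integral>\<^sup>+z. (\<integral>\<^sup>+w. ennreal (norm (cauchy_kernel w) * norm (u (z - axis j w)) powr p) \<partial>lborel) \<partial>lborel)
      = (\<integral>\<^sup>+w. (\<integral>\<^sup>+z. ennreal (norm (cauchy_kernel w) * norm (u (z - axis j w)) powr p) \<partial>lborel) \<partial>lborel)"
    by (rule lborel_pair.Fubini') measurable
  also have "\<dots> = (\<integral>\<^sup>+w. ennreal (norm (cauchy_kernel w)) * (\<integral>\<^sup>+z. ennreal (norm (u z) powr p) \<partial>lborel) \<partial>lborel)"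
  proof (rule nn_integral_cong)
    fix w
    have "(\<integral>\<^sup>+z. ennreal (norm (cauchy_kernel w) * norm (u (z - axis j w)) powr p) \<partial>lborel)
        = ennreal (norm (cauchy_kernel w)) * (\<integral>\<^sup>+z. ennreal (norm (u (z - axis j w)) powr p) \<partial>lborel)"
      by (simp add: ennreal_mult nn_integral_cmult)
    also have "(\<integral>\<^sup>+z. ennreal (norm (u (z - axis j w)) powr p) \<partial>lborel) = (\<integral>\<^sup>+z. ennreal (norm (u z) powr p) \<partial>lborel)"
      using nn_integral_translate[of "\<lambda>z. ennreal (norm (u z) powr p)" "- axis j w"] by simp
    finally show "(\<integral>\<^sup>+z. ennreal (norm (cauchy_kernel w) * norm (u (z - axis j w)) powr p) \<partial>lborel)
        = ennreal (norm (cauchy_kernel w)) * (\<integral>\<^sup>+z. ennreal (norm (u z) powr p) \<partial>lborel)" .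
  qed
  also have "\<dots> = (\<integral>\<^sup>+w. ennreal (norm (cauchy_kernel w)) \<partial>lborel) * (\<integral>\<^sup>+z. ennreal (norm (u z) powr p) \<partial>lborel)"
    by (rule nn_integral_multc) measurable
  also have "ennreal (?K powr (p - 1)) * \<dots> < \<infinity>"
    using fin integrable_cauchy_kernel by (simp add: integrable_iff_bounded ennreal_mult_less_top)
  finally show ?thesis .
qed

text \<open>Convolution along axis \<open>j\<close> spreads the support only in coordinate
  \<open>j\<close>, and there the factor \<eta> cuts it back.\<close>

lemma reg_Lp_mult_cauchy_op:
  assumes u: "u \<in> reg_Lp r \<rho>" and r: "1 \<le> r"
    and \<eta>: "continuous_on UNIV \<eta>" "\<And>z. norm (\<eta> z) \<le> B" "\<And>z. \<eta> z \<noteq> 0 \<Longrightarrow> norm (z $ j) \<le> \<rho>'" and "\<rho> \<le> \<rho>'"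
  shows "(\<lambda>z. \<eta> z * cauchy_op j u z) \<in> reg_Lp r \<rho>'"
proof -
  have [measurable]: "\<eta> \<in> borel_measurable borel" using \<eta>(1) by (rule borel_measurable_continuous_onI)
  note [measurable] = cauchy_op_measurable[OF reg_LpD(1)[OF u]]
  have meas: "(\<lambda>z. \<eta> z * cauchy_op j u z) \<in> borel_measurable borel" by measurable
  have B: "B \<ge> 0" using \<eta>(2)[of 0] norm_ge_zero order.trans by blast
  have supp: "norm (z $ i) \<le> \<rho>'" if nz: "\<eta> z * cauchy_op j u z \<noteq> 0" for z i
  proof (cases "i = j")
    case True
    then show ?thesis using nz \<eta>(3) by auto
  next
    case False
    \<comment> \<open>A nonzero value of the transform needs a nonzero value of \<open>u\<close>
      somewhere on the line, and all points of that line share the coordinate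
      \<open>i\<close>.\<close>
    have "\<exists>w. u (z - axis j w) \<noteq> 0"
    proof (rule ccontr)
      assume "\<not> ?thesis"
      then have "cauchy_op j u z = 0" by (simp add: cauchy_op_def)
      then show False using nz by simp
    qed
    then obtain w where "u (z - axis j w) \<noteq> 0" by blast
    from reg_LpD(2)[OF u this, of i] False have "norm (z $ i) \<le> \<rho>" by (simp add: axis_def)
    then show ?thesis using \<open>\<rho> \<le> \<rho>'\<close> by simp
  qed
  show ?thesis
  proof (cases "r = \<infinity>")
    case True
    obtain C where C: "C \<ge> 0" "\<And>z. norm (u z) \<le> C" using u unfolding True by (metis reg_Lp_topE)
    have "norm (\<eta> z * cauchy_op j u z) \<le> B * ((\<integral>w. norm (cauchy_kernel w) \<partial>lborel) * C)" for z
      unfolding norm_mult using B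
      by (intro mult_mono \<eta>(2) cauchy_op_bounded[OF reg_LpD(1)[OF u] C(2)]) auto
    then show ?thesis using True supp meas by (auto simp: reg_Lp_def)
  next
    case False
    define p where "p = enn2real r"
    have p: "p \<ge> 1" using one_le_enn2real[OF r False] by (simp add: p_def)
    have "(\<integral>\<^sup>+z. ennreal (norm (\<eta> z * cauchy_op j u z) powr p) \<partial>lborel)
        \<le> (\<integral>\<^sup>+z. ennreal (B powr p) * ennreal (norm (cauchy_op j u z) powr p) \<partial>lborel)"
    proof (rule nn_integral_mono)
      fix z
      have "norm (\<eta> z * cauchy_op j u z) powr p \<le> (B * norm (cauchy_op j u z)) powr p"
        using p \<eta>(2) by (intro powr_mono2) (auto simp: norm_mult intro!: mult_right_mono)
      also have "\<dots> = B powr p * norm (cauchy_op j u z) powr p" using B by (intro powr_mult)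
      finally show "ennreal (norm (\<eta> z * cauchy_op j u z) powr p) \<le> ennreal (B powr p) * ennreal (norm (cauchy_op j u z) powr p)"
        by (simp add: ennreal_leI flip: ennreal_mult)
    qed
    also have "\<dots> = ennreal (B powr p) * (\<integral>\<^sup>+z. ennreal (norm (cauchy_op j u z) powr p) \<partial>lborel)"
      by (rule nn_integral_cmult) measurable
    also have "\<dots> < \<infinity>"
      using nn_integral_cauchy_op_powr[OF reg_LpD(1)[OF u] p] reg_LpD(3)[OF u False]
      by (simp add: p_def ennreal_mult_less_top)
    finally show ?thesis using False supp meas by (auto simp: reg_Lp_def p_def)
  qed
qed

lemma integrable_mult_test_fun:
  assumes "integrable lborel u" "test_fun \<phi>"
  shows "integrable lborel (\<lambda>z. u z * \<phi> z)"
proof -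
  obtain B where "\<And>z. norm (\<phi> z) \<le> B" using test_fun_bounded[OF assms(2)] by blast
  then show ?thesis
    using integrable_mult_translate[OF assms(1) _ test_fun_continuous[OF assms(2)], of "\<lambda>z. z" B 0] by simp
qed

text \<open>Fubini is applicable because both the kernel and \<open>u\<close> are integrable while
  the test function is bounded.\<close>

lemma cauchy_op_dual:
  assumes u: "integrable lborel u" and \<phi>: "test_fun \<phi>"
  shows "(\<integral>z. cauchy_op j u z * \<phi> z \<partial>lborel) = (\<integral>z. u z * cauchy_dual j \<phi> z \<partial>lborel)"
proof -
  have [measurable]: "u \<in> borel_measurable borel" using borel_measurable_integrable[OF u] by simp
  note [measurable] = test_fun_measurable[OF \<phi>]
  obtain B where B: "\<And>z. norm (\<phi> z) \<le> B" using test_fun_bounded[OF \<phi>] by blast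
  have B0: "B \<ge> 0" using B[of 0] norm_ge_zero order.trans by blast
  let ?f = "\<lambda>w z. cauchy_kernel w * u (z - axis j w) * \<phi> z"
  have int: "integrable (lborel \<Otimes>\<^sub>M lborel) (\<lambda>(w, z). ?f w z)"
  proof (rule integrableI_bounded)
    show "(\<lambda>(w, z). ?f w z) \<in> borel_measurable (lborel \<Otimes>\<^sub>M lborel)" by measurable
    have "(\<integral>\<^sup>+x. ennreal (norm (case x of (w, z) \<Rightarrow> ?f w z)) \<partial>(lborel \<Otimes>\<^sub>M lborel))
        = (\<integral>\<^sup>+w. \<integral>\<^sup>+z. ennreal (norm (?f w z)) \<partial>lborel \<partial>lborel)"
      by (subst lborel.nn_integral_fst[symmetric]) auto
    also have "\<dots> \<le> (\<integral>\<^sup>+w. ennreal (norm (cauchy_kernel w)) * (ennreal B * (\<integral>\<^sup>+z. ennreal (norm (u z)) \<partial>lborel)) \<partial>lborel)"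
    proof (rule nn_integral_mono)
      fix w
      have "(\<integral>\<^sup>+z. ennreal (norm (?f w z)) \<partial>lborel)
          \<le> (\<integral>\<^sup>+z. ennreal (norm (cauchy_kernel w)) * (ennreal B * ennreal (norm (u (z - axis j w)))) \<partial>lborel)"
      proof (rule nn_integral_mono)
        fix z
        have "norm (?f w z) \<le> norm (cauchy_kernel w) * (B * norm (u (z - axis j w)))"
          using B[of z] mult_left_mono[of "norm (\<phi> z)" B "norm (cauchy_kernel w) * norm (u (z - axis j w))"]
          by (simp add: norm_mult mult_ac)
        then show "ennreal (norm (?f w z)) \<le> ennreal (norm (cauchy_kernel w)) * (ennreal B * ennreal (norm (u (z - axis j w))))"
          using B0 by (simp add: ennreal_leI flip: ennreal_mult)
      qed
      also have "\<dots> = ennreal (norm (cauchy_kernel w)) * (ennreal B * (\<integral>\<^sup>+z. ennreal (norm (u (z - axis j w))) \<partial>lborel))"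
        by (simp add: nn_integral_cmult)
      also have "(\<integral>\<^sup>+z. ennreal (norm (u (z - axis j w))) \<partial>lborel) = (\<integral>\<^sup>+z. ennreal (norm (u z)) \<partial>lborel)"
        using nn_integral_translate[of "\<lambda>z. ennreal (norm (u z))" "- axis j w"] by simp
      finally show "(\<integral>\<^sup>+z. ennreal (norm (?f w z)) \<partial>lborel)
          \<le> ennreal (norm (cauchy_kernel w)) * (ennreal B * (\<integral>\<^sup>+z. ennreal (norm (u z)) \<partial>lborel))" .
    qed
    also have "\<dots> = (\<integral>\<^sup>+w. ennreal (norm (cauchy_kernel w)) \<partial>lborel) * (ennreal B * (\<integral>\<^sup>+z. ennreal (norm (u z)) \<partial>lborel))"
      by (rule nn_integral_multc) measurable
    also have "\<dots> < \<infinity>"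
      using u integrable_cauchy_kernel by (simp add: integrable_iff_bounded ennreal_mult_less_top)
    finally show "(\<integral>\<^sup>+x. ennreal (norm (case x of (w, z) \<Rightarrow> ?f w z)) \<partial>(lborel \<Otimes>\<^sub>M lborel)) < \<infinity>" .
  qed
  have "(\<integral>z. cauchy_op j u z * \<phi> z \<partial>lborel) = (\<integral>z. (\<integral>w. ?f w z \<partial>lborel) \<partial>lborel)"
    by (simp add: cauchy_op_def)
  also have "\<dots> = (\<integral>w. (\<integral>z. ?f w z \<partial>lborel) \<partial>lborel)"
    by (rule lborel_pair.Fubini_integral[OF int])
  \<comment> \<open>The translation by \<open>axis j w\<close> is carried out in the inner integral
    with \<open>w\<close> fixed; this is why the order of integration is exchanged before and
    restored afterwards.\<close>
  also have "\<dots> = (\<integral>w. (\<integral>z. u z * (cauchy_kernel w * \<phi> (z + axis j w)) \<partial>lborel) \<partial>lborel)"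
  proof (rule Bochner_Integration.integral_cong[OF refl])
    fix w
    have "(\<integral>z. ?f w z \<partial>lborel) = (\<integral>z. ?f w z \<partial>distr lborel borel ((+) (axis j w)))"
      by (simp add: lborel_distr_plus)
    also have "\<dots> = (\<integral>z. ?f w (axis j w + z) \<partial>lborel)" by (rule integral_distr) measurable
    finally show "(\<integral>z. ?f w z \<partial>lborel) = (\<integral>z. u z * (cauchy_kernel w * \<phi> (z + axis j w)) \<partial>lborel)"
      by (simp add: mult_ac add.commute)
  qed
  also have "\<dots> = (\<integral>z. (\<integral>w. u z * (cauchy_kernel w * \<phi> (z + axis j w)) \<partial>lborel) \<partial>lborel)"
  proof (rule lborel_pair.Fubini_integral[symmetric])
    show "integrable (lborel \<Otimes>\<^sub>M lborel) (\<lambda>(w, z). u z * (cauchy_kernel w * \<phi> (z + axis j w)))"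
    proof (rule lborel_pair.Fubini_integrable)
      show "(\<lambda>(w, z). u z * (cauchy_kernel w * \<phi> (z + axis j w))) \<in> borel_measurable (lborel \<Otimes>\<^sub>M lborel)"
        by measurable
      have *: "integrable lborel (\<lambda>z. u z * (cauchy_kernel w * \<phi> (z + axis j w)))" for w
      proof -
        have "integrable lborel (\<lambda>z. u z * \<phi> (axis j w + z))"
          by (rule integrable_mult_translate[OF u _ test_fun_continuous[OF \<phi>] B]) simp
        then show ?thesis
          by (subst mult.left_commute) (simp add: add.commute)
      qed
      then show "AE w in lborel. integrable lborel (\<lambda>z. case (w, z) of (w, z) \<Rightarrow> u z * (cauchy_kernel w * \<phi> (z + axis j w)))"
        by simp
      show "integrable lborel (\<lambda>w. \<integral>z. norm (case (w, z) of (w, z) \<Rightarrow> u z * (cauchy_kernel w * \<phi> (z + axis j w))) \<partial>lborel)"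
      proof (rule Bochner_Integration.integrable_bound)
        show "integrable lborel (\<lambda>w. norm (cauchy_kernel w) * (B * (\<integral>z. norm (u z) \<partial>lborel)))"
          using integrable_cauchy_kernel by simp
        show "(\<lambda>w. \<integral>z. norm (case (w, z) of (w, z) \<Rightarrow> u z * (cauchy_kernel w * \<phi> (z + axis j w))) \<partial>lborel) \<in> borel_measurable lborel"
          by measurable
        show "AE w in lborel. norm (\<integral>z. norm (case (w, z) of (w, z) \<Rightarrow> u z * (cauchy_kernel w * \<phi> (z + axis j w))) \<partial>lborel)
            \<le> norm (norm (cauchy_kernel w) * (B * (\<integral>z. norm (u z) \<partial>lborel)))"
        proof (rule AE_I2)
          fix w
          have "(\<integral>z. norm (u z * (cauchy_kernel w * \<phi> (z + axis j w))) \<partial>lborel)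
              \<le> (\<integral>z. norm (cauchy_kernel w) * (B * norm (u z)) \<partial>lborel)"
          proof (rule integral_mono)
            show "integrable lborel (\<lambda>z. norm (u z * (cauchy_kernel w * \<phi> (z + axis j w))))"
              by (rule integrable_norm[OF *])
            show "integrable lborel (\<lambda>z. norm (cauchy_kernel w) * (B * norm (u z)))" using u by simp
            fix z
            show "norm (u z * (cauchy_kernel w * \<phi> (z + axis j w))) \<le> norm (cauchy_kernel w) * (B * norm (u z))"
              using mult_left_mono[OF B[of "z + axis j w"], of "norm (cauchy_kernel w) * norm (u z)"]
              by (simp add: norm_mult mult_ac)
          qed
          then show "norm (\<integral>z. norm (case (w, z) of (w, z) \<Rightarrow> u z * (cauchy_kernel w * \<phi> (z + axis j w))) \<partial>lborel)
            \<le> norm (norm (cauchy_kernel w) * (B * (\<integral>z. norm (u z) \<partial>lborel)))"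
            using B0 by simp
        qed
      qed
    qed
  qed
  also have "\<dots> = (\<integral>z. u z * cauchy_dual j \<phi> z \<partial>lborel)"
    by (simp add: cauchy_dual_def)
  finally show ?thesis .
qed

section \<open>Solving the equation variable by variable\<close>

text \<open>Compactness of the support in the open polydisc provides one radius below 1 for all
  coordinates; the remaining properties are forced everywhere by changes on null sets.\<close>

lemma Lspace_c_representative:
  fixes u :: "complex ^ 'n::finite \<Rightarrow> complex"
  assumes "u \<in> Lspace_c r polydisc"
  obtains v \<rho> where "0 \<le> \<rho>" "\<rho> < 1" "v \<in> reg_Lp r \<rho>" "AE z in lebesgue. u z = v z"
proof -
  from assms have u: "u \<in> borel_measurable lebesgue" "u \<in> Lspace r"
    by (auto simp: Lspace_c_def Lspace_def)
  obtain K where K: "compact K" "K \<subseteq> polydisc" "AE z in lebesgue. z \<notin> K \<longrightarrow> u z = 0"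
    using assms by (auto simp: Lspace_c_def)
  have "\<exists>\<rho>. 0 \<le> \<rho> \<and> \<rho> < 1 \<and> (\<forall>z\<in>K. norm (z $ i) \<le> \<rho>)" for i
  proof (cases "K = {}")
    case False
    have "continuous_on K (\<lambda>z. norm (z $ i))" by (intro continuous_intros)
    from continuous_attains_sup[OF K(1) False this]
    obtain z where "z \<in> K" "\<forall>y\<in>K. norm (y $ i) \<le> norm (z $ i)" by blast
    moreover from this have "norm (z $ i) < 1" using K(2) by (auto simp: polydisc_def)
    ultimately show ?thesis by (intro exI[of _ "norm (z $ i)"]) auto
  qed (auto intro: exI[of _ 0])
  then obtain \<rho>i where \<rho>i: "\<And>i. 0 \<le> \<rho>i i" "\<And>i. \<rho>i i < 1" "\<And>i z. z \<in> K \<Longrightarrow> norm (z $ i) \<le> \<rho>i i"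
    by metis
  define \<rho> where "\<rho> = Max (range \<rho>i)"
  have \<rho>_ge: "\<rho>i i \<le> \<rho>" for i by (simp add: \<rho>_def)
  have "\<rho> \<in> range \<rho>i" unfolding \<rho>_def by (intro Max_in) auto
  then have \<rho>: "0 \<le> \<rho>" "\<rho> < 1" using \<rho>i(1,2) by auto
  have K\<rho>: "norm (z $ i) \<le> \<rho>" if "z \<in> K" for z i
    using \<rho>i(3)[OF that] \<rho>_ge order.trans by blast
  have "(\<lambda>z. Re (u z)) \<in> borel_measurable lebesgue" "(\<lambda>z. Im (u z)) \<in> borel_measurable lebesgue"
    using u(1) by measurable
  then obtain f g where f: "f \<in> borel_measurable lborel" "AE z in lborel. Re (u z) = f z"
    and g: "g \<in> borel_measurable lborel" "AE z in lborel. Im (u z) = g z"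
    using completion_ex_borel_measurable_real by metis
  \<comment> \<open>A Borel version of \<open>u\<close>, assembled from real and imaginary parts;
    the indicator of \<open>K\<close> turns the support condition from almost everywhere into
    everywhere.\<close>
  define w where "w z = indicator K z *\<^sub>R (complex_of_real (f z) + \<i> * complex_of_real (g z))" for z
  have [measurable]: "f \<in> borel_measurable borel" "g \<in> borel_measurable borel" using f g by auto
  have [measurable]: "K \<in> sets borel" using K(1) by (simp add: compact_imp_closed)
  have w_meas [measurable]: "w \<in> borel_measurable borel" unfolding w_def by measurable
  have "AE z in lborel. z \<notin> K \<longrightarrow> u z = 0" using K(3) by (simp add: AE_completion_iff)
  with f(2) g(2) have w_eq: "AE z in lborel. u z = w z"
    by eventually_elim (auto simp: w_def complex_eq_iff split: split_indicator)
  have w_supp: "norm (z $ i) \<le> \<rho>" if "w z \<noteq> 0" for z i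
    using that K\<rho> by (auto simp: w_def split: split_indicator_asm)
  show thesis
  proof (cases "r = \<infinity>")
    case True
    then obtain C where "AE z in lebesgue. norm (u z) \<le> C" using u(2) by (auto simp: Lspace_def)
    then have C: "AE z in lborel. norm (u z) \<le> C" by (simp add: AE_completion_iff)
    \<comment> \<open>Values above the essential bound occur only on a null set and are discarded,
      so that the bound holds everywhere.\<close>
    define v where "v z = (if norm (w z) \<le> C then w z else 0)" for z
    have "norm (v z) \<le> \<bar>C\<bar>" for z by (auto simp: v_def)
    moreover have "v \<in> borel_measurable borel" unfolding v_def by measurable
    moreover have "norm (z $ i) \<le> \<rho>" if "v z \<noteq> 0" for z i
      using that w_supp by (auto simp: v_def split: if_splits)
    ultimately have "v \<in> reg_Lp r \<rho>"
      using True unfolding reg_Lp_def by auto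
    moreover have "AE z in lborel. u z = v z"
      using w_eq C by eventually_elim (auto simp: v_def)
    ultimately show thesis using \<rho> that AE_completion by blast
  next
    case False
    have "(\<integral>\<^sup>+z. ennreal (norm (w z) powr enn2real r) \<partial>lborel) = (\<integral>\<^sup>+z. ennreal (norm (u z) powr enn2real r) \<partial>lborel)"
      using w_eq by (intro nn_integral_cong_AE) (auto elim: eventually_mono)
    also have "\<dots> < \<infinity>"
      using u(2) False by (auto simp: Lspace_def nn_integral_completion)
    finally have "w \<in> reg_Lp r \<rho>" using False w_supp w_meas by (auto simp: reg_Lp_def)
    then show thesis using \<rho> that AE_completion[OF w_eq] by blast
  qed
qed

lemma reg_Lp_imp_Lspace_c:
  fixes u :: "complex ^ 'n::finite \<Rightarrow> complex"
  assumes u: "u \<in> reg_Lp r \<rho>" and "\<rho> < 1"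
  shows "u \<in> Lspace_c r polydisc"
proof -
  define K where "K = {z :: complex ^ 'n. \<forall>i. norm (z $ i) \<le> \<rho>}"
  have "closed K" unfolding K_def by (intro closed_Collect_all closed_Collect_le continuous_intros)
  moreover have "bounded K"
    using norm_vec_le_of_components by (auto simp: bounded_iff K_def)
  ultimately have "compact K" by (simp add: compact_eq_bounded_closed)
  moreover have "K \<subseteq> polydisc"
    using \<open>\<rho> < 1\<close> by (auto simp: K_def polydisc_def intro: order.strict_trans1)
  moreover have "AE z in lebesgue. z \<notin> K \<longrightarrow> u z = 0"
    using reg_LpD(2)[OF u] by (auto simp: K_def)
  moreover have "u \<in> Lspace r"
  proof -
    have "u \<in> borel_measurable lborel" using reg_LpD(1)[OF u] by simp
    then have "u \<in> borel_measurable lebesgue" by (rule measurable_completion)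
    moreover have "\<exists>C. AE z in lebesgue. norm (u z) \<le> C" if top: "r = \<infinity>"
    proof -
      obtain C where "\<forall>z. norm (u z) \<le> C" using u top by (auto simp: reg_Lp_def)
      then show ?thesis by (intro exI[of _ C] AE_I2) simp
    qed
    ultimately show ?thesis
      using reg_LpD(3)[OF u] by (auto simp: Lspace_def nn_integral_completion)
  qed
  ultimately show ?thesis unfolding Lspace_c_def by blast
qed

text \<open>The action on test functions taken over Borel rather than Lebesgue measure, the setting
  in which translation invariance and Fubini were applied to the transforms.\<close>

definition pairing :: "(complex ^ 'n::finite \<Rightarrow> complex) \<Rightarrow> (complex ^ 'n \<Rightarrow> complex) \<Rightarrow> complex" where
  "pairing u \<phi> = (\<integral>z. u z * \<phi> z \<partial>lborel)"

lemma distr_of_eq_pairing: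
  assumes eq: "AE z in lebesgue. u z = v z" and u: "u \<in> borel_measurable lebesgue"
    and v: "v \<in> borel_measurable borel" and \<phi>: "test_fun \<phi>"
  shows "distr_of u \<phi> = pairing v \<phi>"
proof -
  have meas: "\<phi> \<in> borel_measurable lborel" "v \<in> borel_measurable lborel"
    using test_fun_measurable[OF \<phi>] v by auto
  then have "distr_of u \<phi> = (\<integral>z. v z * \<phi> z \<partial>lebesgue)"
    unfolding distr_of_def using eq u
    by (intro integral_cong_AE borel_measurable_times) (auto intro: measurable_completion)
  also have "\<dots> = pairing v \<phi>"
    unfolding pairing_def using meas by (intro integral_completion borel_measurable_times)
  finally show ?thesis .
qed

lemma pairing_zero: "pairing (\<lambda>_. 0) \<phi> = 0"
  by (simp add: pairing_def)

lemma pairing_cmult: "pairing (\<lambda>z. c * u z) \<phi> = c * pairing u \<phi>"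
  by (simp add: pairing_def mult.assoc)

text \<open>Through this rule the support of the coefficients enters: identities between test
  functions are needed only where the coefficient is nonzero, hence where the cutoff is 1.\<close>

lemma pairing_cong:
  assumes "\<And>z. u z \<noteq> 0 \<Longrightarrow> \<phi> z = \<psi> z"
  shows "pairing u \<phi> = pairing u \<psi>"
  unfolding pairing_def using assms by (intro Bochner_Integration.integral_cong) auto

lemma pairing_mult_cauchy_op:
  assumes "integrable lborel u" "\<And>k. Ck k \<eta>" "test_fun \<phi>"
  shows "pairing (\<lambda>z. \<eta> z * cauchy_op j u z) \<phi> = pairing u (cauchy_dual j (\<lambda>z. \<eta> z * \<phi> z))"
  using cauchy_op_dual[OF assms(1) test_fun_mult[OF assms(2,3)]]
  by (simp add: pairing_def mult_ac)

section \<open>Exterior signs and closed families of coefficients\<close>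

definition wedge_sign :: "'n::linorder set \<Rightarrow> 'n \<Rightarrow> complex" where
  "wedge_sign I j = (-1) ^ card {i \<in> I. i < j}"

lemma wedge_sign_square: "wedge_sign I j * wedge_sign I j = 1"
  by (simp add: wedge_sign_def flip: power_mult_distrib)

text \<open>Anticommutativity of the exterior product: extracting \<open>i\<close> and
  \<open>j\<close> from \<open>insert j I\<close> in the two possible orders. The larger of the two
  indices is the one whose count changes, by one.\<close>

lemma wedge_sign_swap:
  fixes I :: "'n::{finite,linorder} set"
  assumes "i \<in> I" "j \<notin> I"
  shows "wedge_sign I i * wedge_sign (insert j (I - {i})) j
    = - (wedge_sign (insert j I) i * wedge_sign (insert j I) j)"
proof (cases "i < j")
  case True
  then have "{x \<in> insert j I. x < i} = {x \<in> I. x < i}" by auto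
  moreover have "{x \<in> insert j I. x < j} = insert i {x \<in> insert j (I - {i}). x < j}"
    using True assms by auto
  ultimately show ?thesis by (simp add: wedge_sign_def)
next
  case False
  then have "j < i" using assms by (metis linorder_neqE)
  then have "{x \<in> insert j I. x < i} = insert j {x \<in> I. x < i}" by auto
  moreover have "{x \<in> insert j I. x < j} = {x \<in> insert j (I - {i}). x < j}"
    using \<open>j < i\<close> by auto
  ultimately show ?thesis using assms by (simp add: wedge_sign_def)
qed

text \<open>The coefficient at \<open>I\<close> of the conjugate exterior derivative, evaluated at a
  test function; the common minus sign is that of the distributional derivative.\<close>

definition weak_dbar ::
    "('n set \<Rightarrow> complex ^ 'n::{finite,linorder} \<Rightarrow> complex) \<Rightarrow> 'n set \<Rightarrow> (complex ^ 'n::{finite,linorder} \<Rightarrow> complex) \<Rightarrow> complex"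
  where "weak_dbar \<beta> I \<phi> = - (\<Sum>i\<in>I. wedge_sign I i * pairing (\<beta> (I - {i})) (dbar_fun i \<phi>))"

definition weakly_closed :: "nat \<Rightarrow> ('n set \<Rightarrow> complex ^ 'n::{finite,linorder} \<Rightarrow> complex) \<Rightarrow> bool" where
  "weakly_closed q \<omega> \<longleftrightarrow> (\<forall>L \<phi>. card L = q + 1 \<longrightarrow> test_fun \<phi> \<longrightarrow> weak_dbar \<omega> L \<phi> = 0)"

definition reg_form :: "ennreal \<Rightarrow> real \<Rightarrow> nat \<Rightarrow> ('n set \<Rightarrow> complex ^ 'n::finite \<Rightarrow> complex) \<Rightarrow> bool" where
  "reg_form r \<rho> q \<omega> \<longleftrightarrow> (\<forall>I. card I = q \<longrightarrow> \<omega> I \<in> reg_Lp r \<rho>)"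

lemma reg_formD: "reg_form r \<rho> q \<omega> \<Longrightarrow> card I = q \<Longrightarrow> \<omega> I \<in> reg_Lp r \<rho>"
  by (simp add: reg_form_def)

lemma weakly_closedD:
  assumes "weakly_closed q \<omega>" "card L = q + 1" "test_fun \<phi>"
  shows "(\<Sum>i\<in>L. wedge_sign L i * pairing (\<omega> (L - {i})) (dbar_fun i \<phi>)) = 0"
proof -
  have "weak_dbar \<omega> L \<phi> = 0" using assms unfolding weakly_closed_def by blast
  then show ?thesis by (simp add: weak_dbar_def)
qed

text \<open>Elimination of one variable. The alternative that the old coefficient is already 0
  preserves the zeros produced for earlier variables, so that successive eliminations
  accumulate.\<close>

lemma closed_form_reduce:
  fixes \<omega> :: "'n set \<Rightarrow> complex ^ 'n::{finite,linorder} \<Rightarrow> complex" and j :: 'n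
  assumes r: "1 \<le> r" and \<rho>: "0 \<le> \<rho>" "\<rho> < 1" and q: "1 \<le> q"
    and reg: "reg_form r \<rho> q \<omega>" and closed: "weakly_closed q \<omega>"
  obtains \<beta> \<omega>' \<rho>' where "\<rho> \<le> \<rho>'" "\<rho>' < 1" "reg_form r \<rho>' (q - 1) \<beta>" "reg_form r \<rho>' q \<omega>'"
    "weakly_closed q \<omega>'" "\<forall>I. j \<notin> I \<or> \<omega> I = (\<lambda>_. 0) \<longrightarrow> \<omega>' I = (\<lambda>_. 0)"
    "\<forall>I \<phi>. card I = q \<longrightarrow> test_fun \<phi> \<longrightarrow> weak_dbar \<beta> I \<phi> = pairing (\<omega> I) \<phi> - pairing (\<omega>' I) \<phi>"
proof -
  note \<omega> = reg_formD[OF reg]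
  obtain \<theta> :: "complex ^ 'n::{finite,linorder} \<Rightarrow> complex" and \<rho>' where \<rho>': "\<rho> \<le> \<rho>'" "\<rho>' < 1"
    and C: "\<And>k. Ck k \<theta>" and only: "only_coord j \<theta>"
    and inner: "\<And>z. norm (z $ j) \<le> \<rho> \<Longrightarrow> \<theta> z = 1 \<and> dbar_fun j \<theta> z = 0"
    and outer: "\<And>z. norm (z $ j) > \<rho>' \<Longrightarrow> \<theta> z = 0 \<and> dbar_fun j \<theta> z = 0"
    by (rule cutoff_exists[OF \<rho>, of j]) (rule that)
  define \<eta> where "\<eta> z = - dbar_fun j \<theta> z" for z
  have C\<eta>: "Ck k \<eta>" for k
    using Ck_mult[OF Ck_const[of k "-1"] Ck_dbar_fun[OF C, of k j]] by (simp add: \<eta>_def[abs_def])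
  have only\<eta>: "only_coord j \<eta>"
    unfolding only_coord_def \<eta>_def
    by (intro allI impI arg_cong[where f = uminus] only_coordD[OF only_coord_dbar_fun[OF only]])
  \<comment> \<open>Contraction with the differential of the conjugate of \<open>z $ j\<close>: the
    sign is the one that extracts \<open>j\<close> from \<open>insert j K\<close>, and sets
    containing \<open>j\<close> get coefficient 0.\<close>
  define \<beta> where "\<beta> K = (if j \<in> K then (\<lambda>_. 0)
    else (\<lambda>z. (wedge_sign (insert j K) j * \<theta> z) * cauchy_op j (\<omega> (insert j K)) z))" for K
  define \<omega>' where "\<omega>' I = (if j \<in> I then (\<lambda>z. \<eta> z * cauchy_op j (\<omega> I) z) else (\<lambda>_. 0))" for I
  show thesis
  proof (rule that[of \<rho>' \<beta> \<omega>'])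
    show "\<rho> \<le> \<rho>'" "\<rho>' < 1" by fact+
    \<comment> \<open>A nonzero function of coordinate \<open>j\<close> alone need not have bounded
      support in the whole space, so its bound comes from the slice \<open>f\<close> on the plane,
      whose support is bounded.\<close>
    have bounded: "\<exists>B. \<forall>z. norm (\<zeta> z) \<le> B"
      if "\<And>k. Ck k \<zeta>" "only_coord j \<zeta>" "\<And>z. norm (z $ j) > \<rho>' \<Longrightarrow> \<zeta> z = 0" for \<zeta>
    proof -
      define f where "f w = \<zeta> (axis j w)" for w
      have f: "\<zeta> z = f (z $ j)" for z
        unfolding f_def by (rule only_coordD[OF that(2)]) (simp add: axis_def)
      have "continuous_on UNIV f"
        unfolding f_def
        by (rule continuous_on_compose2[OF Ck_imp_continuous_on[OF that(1)]
              linear_continuous_on[OF bounded_linear_axis]]) auto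
      moreover have "f w = 0" if "norm w > \<rho>'" for w
        using that \<open>\<And>z. norm (z $ j) > \<rho>' \<Longrightarrow> \<zeta> z = 0\<close>[of "axis j w"] by (simp add: f_def axis_def)
      ultimately obtain B where "\<And>w. norm (f w) \<le> B" using bounded_of_support by metis
      then show ?thesis using f by auto
    qed
    obtain B\<theta> where B\<theta>: "\<And>z. norm (\<theta> z) \<le> B\<theta>" using bounded[OF C only] outer by blast
    obtain B\<eta> where B\<eta>: "\<And>z. norm (\<eta> z) \<le> B\<eta>"
      using bounded[OF C\<eta> only\<eta>] outer by (auto simp: \<eta>_def)
    have "\<beta> K \<in> reg_Lp r \<rho>'" if "card K = q - 1" for K
    proof (cases "j \<in> K")
      case True
      then show ?thesis by (simp add: \<beta>_def reg_Lp_zero)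
    next
      case False
      have "card (insert j K) = q" using that False q by simp
      from \<omega>[OF this] have "(\<lambda>z. (wedge_sign (insert j K) j * \<theta> z) * cauchy_op j (\<omega> (insert j K)) z) \<in> reg_Lp r \<rho>'"
      proof (rule reg_Lp_mult_cauchy_op[OF _ r])
        show "continuous_on UNIV (\<lambda>z. wedge_sign (insert j K) j * \<theta> z)"
          by (intro continuous_intros Ck_imp_continuous_on[OF C])
        show "norm (wedge_sign (insert j K) j * \<theta> z) \<le> B\<theta>" for z
          using B\<theta> by (simp add: norm_mult wedge_sign_def norm_power)
        show "norm (z $ j) \<le> \<rho>'" if "wedge_sign (insert j K) j * \<theta> z \<noteq> 0" for z
          using that outer[of z] by (cases "norm (z $ j) > \<rho>'") auto
      qed fact
      then show ?thesis using False by (simp add: \<beta>_def)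
    qed
    then show "reg_form r \<rho>' (q - 1) \<beta>" by (simp add: reg_form_def)
    have "\<omega>' I \<in> reg_Lp r \<rho>'" if "card I = q" for I
    proof (cases "j \<in> I")
      case True
      from \<omega>[OF that] have "(\<lambda>z. \<eta> z * cauchy_op j (\<omega> I) z) \<in> reg_Lp r \<rho>'"
      proof (rule reg_Lp_mult_cauchy_op[OF _ r])
        show "continuous_on UNIV \<eta>" by (rule Ck_imp_continuous_on[OF C\<eta>])
        show "norm (\<eta> z) \<le> B\<eta>" for z by (rule B\<eta>)
        show "norm (z $ j) \<le> \<rho>'" if "\<eta> z \<noteq> 0" for z
          using that outer[of z] by (cases "norm (z $ j) > \<rho>'") (auto simp: \<eta>_def)
      qed fact
      then show ?thesis using True by (simp add: \<omega>'_def)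
    qed (simp add: \<omega>'_def reg_Lp_zero)
    then show "reg_form r \<rho>' q \<omega>'" by (simp add: reg_form_def)
    show "\<forall>I. j \<notin> I \<or> \<omega> I = (\<lambda>_. 0) \<longrightarrow> \<omega>' I = (\<lambda>_. 0)"
      by (auto simp: \<omega>'_def cauchy_op_def)
    have small: "norm (z $ j) \<le> \<rho>" if "card I = q" "\<omega> I z \<noteq> 0" for I z
      using reg_LpD(2)[OF \<omega>[OF that(1)] that(2)] .
    have int: "integrable lborel (\<omega> I)" if "card I = q" for I
      by (rule reg_Lp_integrable[OF \<omega>[OF that] r])
    have supp\<theta>: "norm (z $ j) < 1" if "\<theta> z \<noteq> 0" for z
      using that outer[of z] \<rho>'(2) by (cases "norm (z $ j) > \<rho>'") auto
    have supp\<eta>: "norm (z $ j) < 1" if "\<eta> z \<noteq> 0" for z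
      using that outer[of z] \<rho>'(2) by (cases "norm (z $ j) > \<rho>'") (auto simp: \<eta>_def)
    show "weakly_closed q \<omega>'"
      unfolding weakly_closed_def
    proof (intro allI impI)
      fix L :: "'n set" and \<phi> :: "complex ^ 'n::{finite,linorder} \<Rightarrow> complex"
      assume L: "card L = q + 1" and \<phi>: "test_fun \<phi>"
      show "weak_dbar \<omega>' L \<phi> = 0"
      proof (cases "j \<in> L")
        case False
        then show ?thesis by (simp add: weak_dbar_def \<omega>'_def pairing_zero)
      next
        case True
        \<comment> \<open>Testing the new form with \<phi> amounts to testing the old one with this
          transposed image of \<phi> under P, so closedness is inherited term by term.\<close>
        define \<psi> where "\<psi> = cauchy_dual j (\<lambda>z. \<eta> z * \<phi> z)"
        have \<psi>: "test_fun \<psi>" unfolding \<psi>_def by (intro test_fun_cauchy_dual test_fun_mult C\<eta> \<phi>)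
        have "pairing (\<omega>' (L - {i})) (dbar_fun i \<phi>) = pairing (\<omega> (L - {i})) (dbar_fun i \<psi>)" if "i \<in> L" for i
        proof -
          have card: "card (L - {i}) = q" using L that by simp
          show ?thesis
          proof (cases "i = j")
            \<comment> \<open>Here the new coefficient is 0 by definition, and the old one pairs to
              0 because \<eta> vanishes on its support; this is P D u = 0.\<close>
            case True
            have "pairing (\<omega> (L - {i})) (dbar_fun i \<psi>) = pairing (\<omega> (L - {i})) (\<lambda>_. 0)"
            proof (rule pairing_cong)
              fix z
              assume "\<omega> (L - {i}) z \<noteq> 0"
              then have z: "norm (z $ j) \<le> \<rho>" by (rule small[OF card])
              then have "norm (z $ j) < 1" using \<rho> by simp
              then have "dbar_fun j \<psi> z = - (\<eta> z * \<phi> z)"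
                unfolding \<psi>_def using C\<eta> \<phi> supp\<eta> by (intro dbar_cauchy_dual_mult_same)
              then show "dbar_fun i \<psi> z = 0" using inner[OF z] True by (simp add: \<eta>_def)
            qed
            then show ?thesis using True by (simp add: \<omega>'_def pairing_def)
          next
            case False
            then have "pairing (\<omega>' (L - {i})) (dbar_fun i \<phi>)
                = pairing (\<lambda>z. \<eta> z * cauchy_op j (\<omega> (L - {i})) z) (dbar_fun i \<phi>)"
              using \<open>j \<in> L\<close> by (simp add: \<omega>'_def)
            also have "\<dots> = pairing (\<omega> (L - {i})) (cauchy_dual j (\<lambda>z. \<eta> z * dbar_fun i \<phi> z))"
              by (rule pairing_mult_cauchy_op[OF int[OF card] C\<eta> test_fun_dbar_fun[OF \<phi>]])
            also have "cauchy_dual j (\<lambda>z. \<eta> z * dbar_fun i \<phi> z) = dbar_fun i \<psi>"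
              unfolding \<psi>_def by (rule dbar_cauchy_dual_mult_other[OF C\<eta> only\<eta> \<phi> False, symmetric])
            finally show ?thesis .
          qed
        qed
        then have "(\<Sum>i\<in>L. wedge_sign L i * pairing (\<omega>' (L - {i})) (dbar_fun i \<phi>))
            = (\<Sum>i\<in>L. wedge_sign L i * pairing (\<omega> (L - {i})) (dbar_fun i \<psi>))"
          by (intro sum.cong) auto
        also have "\<dots> = 0" by (rule weakly_closedD[OF closed L \<psi>])
        finally show ?thesis by (simp add: weak_dbar_def)
      qed
    qed
    have "weak_dbar \<beta> I \<phi> = pairing (\<omega> I) \<phi> - pairing (\<omega>' I) \<phi>"
      if I: "card I = q" and \<phi>: "test_fun \<phi>" for I \<phi>
    proof (cases "j \<in> I")
      \<comment> \<open>Only the term \<open>i = j\<close> survives, since every other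
        \<open>I - {i}\<close> still contains \<open>j\<close>. The two equal signs cancel and D S u
        = u - P u remains.\<close>
      case True
      have "(\<Sum>i\<in>I. wedge_sign I i * pairing (\<beta> (I - {i})) (dbar_fun i \<phi>))
          = wedge_sign I j * pairing (\<beta> (I - {j})) (dbar_fun j \<phi>)"
      proof -
        have "\<beta> (I - {i}) = (\<lambda>_. 0)" if "i \<noteq> j" for i
          using True that by (simp add: \<beta>_def)
        then show ?thesis
          using True by (subst sum.remove[of I j]) (auto simp: pairing_zero intro!: sum.neutral)
      qed
      also have "pairing (\<beta> (I - {j})) (dbar_fun j \<phi>)
          = wedge_sign I j * pairing (\<lambda>z. \<theta> z * cauchy_op j (\<omega> I) z) (dbar_fun j \<phi>)"
        using True by (simp add: \<beta>_def insert_absorb mult.assoc flip: pairing_cmult)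
      also have "pairing (\<lambda>z. \<theta> z * cauchy_op j (\<omega> I) z) (dbar_fun j \<phi>)
          = pairing (\<omega> I) (cauchy_dual j (\<lambda>z. \<theta> z * dbar_fun j \<phi> z))"
        by (rule pairing_mult_cauchy_op[OF int[OF I] C test_fun_dbar_fun[OF \<phi>]])
      also have "\<dots> = pairing (\<omega> I) (\<lambda>z. cauchy_dual j (\<lambda>z. \<eta> z * \<phi> z) z - \<phi> z)"
      proof (rule pairing_cong)
        fix z
        assume "\<omega> I z \<noteq> 0"
        then have z: "norm (z $ j) \<le> \<rho>" by (rule small[OF I])
        then have z1: "norm (z $ j) < 1" using \<rho> by simp
        have "cauchy_dual j (\<lambda>z. \<eta> z * \<phi> z) z = - cauchy_dual j (\<lambda>z. dbar_fun j \<theta> z * \<phi> z) z"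
          using cauchy_dual_cmult[of j "-1" "\<lambda>z. dbar_fun j \<theta> z * \<phi> z" z] by (simp add: \<eta>_def)
        moreover have "cauchy_dual j (\<lambda>z. \<theta> z * dbar_fun j \<phi> z) z
            = - (\<theta> z * \<phi> z) - cauchy_dual j (\<lambda>z. dbar_fun j \<theta> z * \<phi> z) z"
          using C \<phi> supp\<theta> z1 by (intro cauchy_dual_mult_dbar)
        ultimately show "cauchy_dual j (\<lambda>z. \<theta> z * dbar_fun j \<phi> z) z = cauchy_dual j (\<lambda>z. \<eta> z * \<phi> z) z - \<phi> z"
          using inner[OF z] by simp
      qed
      also have "\<dots> = pairing (\<omega> I) (cauchy_dual j (\<lambda>z. \<eta> z * \<phi> z)) - pairing (\<omega> I) \<phi>"
        unfolding pairing_def right_diff_distrib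
        by (intro Bochner_Integration.integral_diff integrable_mult_test_fun int[OF I] \<phi>
            test_fun_cauchy_dual test_fun_mult C\<eta>)
      also have "pairing (\<omega> I) (cauchy_dual j (\<lambda>z. \<eta> z * \<phi> z)) = pairing (\<omega>' I) \<phi>"
        using True pairing_mult_cauchy_op[OF int[OF I] C\<eta> \<phi>, of j] by (simp add: \<omega>'_def)
      finally show ?thesis
        using wedge_sign_square[of I j] by (simp add: weak_dbar_def flip: mult.assoc)
    next
      \<comment> \<open>Closedness is used on \<open>insert j I\<close>: its term for
        \<open>j\<close> gives S D u = u for the coefficient at \<open>I\<close>, while by
        \<open>wedge_sign_swap\<close> the other terms make up the derivative of \<beta>.\<close>
      case False
      define L where "L = insert j I"
      have L: "card L = q + 1" using I False by (simp add: L_def)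
      define \<psi> where "\<psi> = cauchy_dual j (\<lambda>z. \<theta> z * \<phi> z)"
      have \<psi>: "test_fun \<psi>" unfolding \<psi>_def by (intro test_fun_cauchy_dual test_fun_mult C \<phi>)
      have summand: "wedge_sign I i * pairing (\<beta> (I - {i})) (dbar_fun i \<phi>)
          = - wedge_sign L j * (wedge_sign L i * pairing (\<omega> (L - {i})) (dbar_fun i \<psi>))" if i: "i \<in> I" for i
      proof -
        have "i \<noteq> j" using i False by auto
        then have eq: "insert j (I - {i}) = L - {i}" by (auto simp: L_def)
        have card: "card (L - {i}) = q" using L i by (simp add: L_def)
        have "pairing (\<beta> (I - {i})) (dbar_fun i \<phi>)
            = wedge_sign (L - {i}) j * pairing (\<lambda>z. \<theta> z * cauchy_op j (\<omega> (L - {i})) z) (dbar_fun i \<phi>)"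
          using False by (simp add: \<beta>_def eq mult.assoc flip: pairing_cmult)
        also have "pairing (\<lambda>z. \<theta> z * cauchy_op j (\<omega> (L - {i})) z) (dbar_fun i \<phi>)
            = pairing (\<omega> (L - {i})) (cauchy_dual j (\<lambda>z. \<theta> z * dbar_fun i \<phi> z))"
          by (rule pairing_mult_cauchy_op[OF int[OF card] C test_fun_dbar_fun[OF \<phi>]])
        also have "cauchy_dual j (\<lambda>z. \<theta> z * dbar_fun i \<phi> z) = dbar_fun i \<psi>"
          unfolding \<psi>_def by (rule dbar_cauchy_dual_mult_other[OF C only \<phi> \<open>i \<noteq> j\<close>, symmetric])
        finally have "wedge_sign I i * pairing (\<beta> (I - {i})) (dbar_fun i \<phi>)
            = (wedge_sign I i * wedge_sign (insert j (I - {i})) j) * pairing (\<omega> (L - {i})) (dbar_fun i \<psi>)"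
          by (simp add: eq)
        then show ?thesis
          unfolding wedge_sign_swap[OF i False] by (simp add: L_def mult_ac)
      qed
      have "pairing (\<omega> I) (dbar_fun j \<psi>) = pairing (\<omega> I) (\<lambda>z. - 1 * \<phi> z)"
      proof (rule pairing_cong)
        fix z
        assume "\<omega> I z \<noteq> 0"
        then have z: "norm (z $ j) \<le> \<rho>" by (rule small[OF I])
        then have "norm (z $ j) < 1" using \<rho> by simp
        then have "dbar_fun j \<psi> z = - (\<theta> z * \<phi> z)"
          unfolding \<psi>_def using C \<phi> supp\<theta> by (intro dbar_cauchy_dual_mult_same)
        then show "dbar_fun j \<psi> z = - 1 * \<phi> z" using inner[OF z] by simp
      qed
      also have "\<dots> = - pairing (\<omega> I) \<phi>" by (simp add: pairing_def)
      finally have same: "pairing (\<omega> I) (dbar_fun j \<psi>) = - pairing (\<omega> I) \<phi>" .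
      have "0 = (\<Sum>i\<in>L. wedge_sign L i * pairing (\<omega> (L - {i})) (dbar_fun i \<psi>))"
        using weakly_closedD[OF closed L \<psi>] by simp
      also have "\<dots> = wedge_sign L j * pairing (\<omega> I) (dbar_fun j \<psi>)
          + (\<Sum>i\<in>I. wedge_sign L i * pairing (\<omega> (L - {i})) (dbar_fun i \<psi>))"
        using False by (subst sum.remove[of L j]) (auto simp: L_def)
      finally have sum: "(\<Sum>i\<in>I. wedge_sign L i * pairing (\<omega> (L - {i})) (dbar_fun i \<psi>)) = wedge_sign L j * pairing (\<omega> I) \<phi>"
        using same by simp
      have "(\<Sum>i\<in>I. wedge_sign I i * pairing (\<beta> (I - {i})) (dbar_fun i \<phi>))
          = - wedge_sign L j * (\<Sum>i\<in>I. wedge_sign L i * pairing (\<omega> (L - {i})) (dbar_fun i \<psi>))"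
        unfolding sum_distrib_left by (intro sum.cong refl summand)
      also have "\<dots> = - pairing (\<omega> I) \<phi>"
        unfolding sum using wedge_sign_square[of L j] by (simp flip: mult.assoc)
      finally show ?thesis using False by (simp add: weak_dbar_def \<omega>'_def pairing_zero)
    qed
    then show "\<forall>I \<phi>. card I = q \<longrightarrow> test_fun \<phi> \<longrightarrow>
        weak_dbar \<beta> I \<phi> = pairing (\<omega> I) \<phi> - pairing (\<omega>' I) \<phi>"
      by blast
  qed
qed

text \<open>Induction on the number of variables outside \<open>A\<close>, the set of those already
  eliminated: coefficients can be nonzero only at sets containing \<open>A\<close>. Primitives of
  the successive steps add up.\<close>

lemma dbar_solvable:
  fixes \<omega> :: "'n set \<Rightarrow> complex ^ 'n::{finite,linorder} \<Rightarrow> complex"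
  assumes r: "1 \<le> r" and q: "1 \<le> q" "q < CARD('n)"
    and "0 \<le> \<rho>" "\<rho> < 1" "reg_form r \<rho> q \<omega>" "weakly_closed q \<omega>"
    and "\<forall>I. \<not> A \<subseteq> I \<longrightarrow> \<omega> I = (\<lambda>_. 0)"
  shows "\<exists>\<beta> \<rho>'. \<rho>' < 1 \<and> reg_form r \<rho>' (q - 1) \<beta> \<and>
    (\<forall>I \<phi>. card I = q \<longrightarrow> test_fun \<phi> \<longrightarrow> weak_dbar \<beta> I \<phi> = pairing (\<omega> I) \<phi>)"
  using assms(4-)
proof (induction "card (- A)" arbitrary: A \<omega> \<rho>)
  case 0
  then have "A = UNIV" by (metis card_eq_0_iff double_complement finite_code Compl_empty_eq)
  have "\<omega> I = (\<lambda>_. 0)" if "card I = q" for I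
  proof -
    have "I \<noteq> UNIV" using that q(2) by auto
    then show ?thesis using 0(6) \<open>A = UNIV\<close> by auto
  qed
  then show ?case
    by (intro exI[of _ "\<lambda>_ _. 0"] exI[of _ "0::real"])
       (auto simp: reg_form_def weak_dbar_def reg_Lp_zero pairing_zero)
next
  case (Suc m)
  then have "- A \<noteq> {}" by force
  then obtain j where j: "j \<notin> A" by auto
  obtain \<beta>1 \<omega>' \<rho>' where step: "\<rho> \<le> \<rho>'" "\<rho>' < 1" "reg_form r \<rho>' (q - 1) \<beta>1" "reg_form r \<rho>' q \<omega>'"
    "weakly_closed q \<omega>'" "\<forall>I. j \<notin> I \<or> \<omega> I = (\<lambda>_. 0) \<longrightarrow> \<omega>' I = (\<lambda>_. 0)"
    "\<forall>I \<phi>. card I = q \<longrightarrow> test_fun \<phi> \<longrightarrow> weak_dbar \<beta>1 I \<phi> = pairing (\<omega> I) \<phi> - pairing (\<omega>' I) \<phi>"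
    by (rule closed_form_reduce[OF r Suc.prems(1,2) q(1) Suc.prems(3,4), of j]) (rule that)
  have "m = card (- insert j A)"
  proof -
    have "- insert j A = - A - {j}" by auto
    then show ?thesis using Suc(2) j by simp
  qed
  moreover have "\<forall>I. \<not> insert j A \<subseteq> I \<longrightarrow> \<omega>' I = (\<lambda>_. 0)"
    using step(6) Suc.prems(5) by blast
  moreover have "0 \<le> \<rho>'" using step(1) Suc.prems(1) by simp
  ultimately obtain \<beta>2 \<rho>'' where IH: "\<rho>'' < 1" "reg_form r \<rho>'' (q - 1) \<beta>2"
    "\<forall>I \<phi>. card I = q \<longrightarrow> test_fun \<phi> \<longrightarrow> weak_dbar \<beta>2 I \<phi> = pairing (\<omega>' I) \<phi>"
    using Suc.hyps(1)[of "insert j A" \<rho>' \<omega>'] step(2,4,5) by blast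
  define \<beta> where "\<beta> K z = \<beta>1 K z + \<beta>2 K z" for K z
  \<comment> \<open>The two primitives come with different radii; both are viewed with the larger
    one, which is still below 1.\<close>
  have "\<beta> K \<in> reg_Lp r (max \<rho>' \<rho>'')" if "card K = q - 1" for K
    unfolding \<beta>_def[abs_def]
    using reg_Lp_add[OF reg_Lp_mono[OF reg_formD[OF step(3) that]] reg_Lp_mono[OF reg_formD[OF IH(2) that]],
        of "max \<rho>' \<rho>''"] by simp
  then have "reg_form r (max \<rho>' \<rho>'') (q - 1) \<beta>" by (simp add: reg_form_def)
  moreover have "weak_dbar \<beta> I \<phi> = pairing (\<omega> I) \<phi>"
    if I: "card I = q" and \<phi>: "test_fun \<phi>" for I \<phi>
  proof -
    have "pairing (\<beta> (I - {i})) (dbar_fun i \<phi>)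
        = pairing (\<beta>1 (I - {i})) (dbar_fun i \<phi>) + pairing (\<beta>2 (I - {i})) (dbar_fun i \<phi>)" if "i \<in> I" for i
    proof -
      have "card (I - {i}) = q - 1" using I that by simp
      note int = reg_Lp_integrable[OF reg_formD[OF step(3) this] r] reg_Lp_integrable[OF reg_formD[OF IH(2) this] r]
      show ?thesis
        unfolding pairing_def \<beta>_def distrib_right
        by (intro Bochner_Integration.integral_add integrable_mult_test_fun int test_fun_dbar_fun \<phi>)
    qed
    then have "weak_dbar \<beta> I \<phi> = weak_dbar \<beta>1 I \<phi> + weak_dbar \<beta>2 I \<phi>"
      by (simp add: weak_dbar_def distrib_left sum.distrib)
    then show ?thesis using step(7) IH(3) I \<phi> by simp
  qed
  moreover have "max \<rho>' \<rho>'' < 1" using step(2) IH(1) by simp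
  ultimately show ?case by blast
qed

text \<open>Agreement is required only on the functions \<open>dbar_fun i \<phi>\<close>, so the
  lemma serves both the given form with its Borel representatives and the constructed
  primitive.\<close>

lemma dbar_form_form_of:
  fixes \<beta> :: "'n set \<Rightarrow> complex ^ 'n::{finite,linorder} \<Rightarrow> complex"
  assumes "\<And>i. i \<in> I \<Longrightarrow> distr_of (\<beta> (I - {i})) (dbar_fun i \<phi>) = pairing (v (I - {i})) (dbar_fun i \<phi>)"
  shows "dbar_form (form_of \<beta>) I \<phi> = weak_dbar v I \<phi>"
  unfolding weak_dbar_def sum_negf[symmetric] dbar_form_def
  by (intro sum.cong refl) (simp add: dbar_distr_def form_of_def wedge_sign_def assms)

theorem theorem8p1:
  fixes q :: nat and r :: ennreal
    and \<omega> :: "'n set \<Rightarrow> complex ^ 'n::{finite,linorder} \<Rightarrow> complex"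
  assumes "1 < q" and "q < CARD('n) - 1"
    and "1 \<le> r" and "r \<le> \<infinity>"
    and "\<And>J. card J = CARD('n) - q \<Longrightarrow> \<omega> J \<in> Lspace_c r polydisc"
    and "form_eq (q + 1) (dbar_form (hat_form_of \<omega>)) zero_form"
    and "\<And>J k. card J = CARD('n) - q \<Longrightarrow> k \<in> {1..CARD('n) - q} \<Longrightarrow>
           distr_in_Lspace r
             (fold dbar_distr (drop (k - 1) (sorted_list_of_set J)) (distr_of (\<omega> J)))"
  shows "\<exists>\<beta> :: 'n set \<Rightarrow> complex ^ 'n::{finite,linorder} \<Rightarrow> complex.
           (\<forall>I. card I = q - 1 \<longrightarrow> \<beta> I \<in> Lspace_c r polydisc) \<and>
           form_eq q (dbar_form (form_of \<beta>)) (hat_form_of \<omega>)"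
proof -
  have hat: "hat_form_of \<omega> = form_of (\<lambda>I. \<omega> (- I))"
    by (simp add: hat_form_of_def form_of_def)
  have mem: "\<omega> (- I) \<in> Lspace_c r polydisc" if "card I = q" for I
    using that by (intro assms(5)) (simp add: Compl_eq_Diff_UNIV card_Diff_subset)
  \<comment> \<open>Sets of other cardinality receive an arbitrary function and radius 0, so that
    radii exist for all sets and their finite maximum can be taken.\<close>
  have "\<exists>v \<rho>. 0 \<le> \<rho> \<and> \<rho> < 1 \<and> (card I = q \<longrightarrow> v \<in> reg_Lp r \<rho> \<and> (AE z in lebesgue. \<omega> (- I) z = v z))"
    for I :: "'n set"
  proof (cases "card I = q")
    case True
    from Lspace_c_representative[OF mem[OF True]] show ?thesis by metis
  next
    case False
    then show ?thesis by (intro exI[of _ undefined] exI[of _ "0::real"]) simp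
  qed
  then obtain v \<rho> where \<rho>: "\<And>I. 0 \<le> \<rho> I" "\<And>I. \<rho> I < 1"
    and v: "\<And>I. card I = q \<Longrightarrow> v I \<in> reg_Lp r (\<rho> I)"
    "\<And>I. card I = q \<Longrightarrow> AE z in lebesgue. \<omega> (- I) z = v I z"
    by metis
  define \<rho>0 where "\<rho>0 = Max (range \<rho>)"
  have "\<rho>0 \<in> range \<rho>" unfolding \<rho>0_def by (intro Max_in) auto
  then have \<rho>0: "0 \<le> \<rho>0" "\<rho>0 < 1" using \<rho> by auto
  have v0: "v I \<in> reg_Lp r \<rho>0" if "card I = q" for I
    by (rule reg_Lp_mono[OF v(1)[OF that]]) (simp add: \<rho>0_def)
  have distr: "distr_of (\<omega> (- I)) \<phi> = pairing (v I) \<phi>" if "card I = q" "test_fun \<phi>" for I \<phi>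
    using mem[OF that(1)] that
    by (intro distr_of_eq_pairing v reg_LpD(1)[OF v0]) (auto simp: Lspace_c_def Lspace_def)
  have "weakly_closed q v"
    unfolding weakly_closed_def
  proof (intro allI impI)
    fix L :: "'n set" and \<phi> :: "complex ^ 'n::{finite,linorder} \<Rightarrow> complex"
    assume L: "card L = q + 1" and \<phi>: "test_fun \<phi>"
    have "dbar_form (hat_form_of \<omega>) L \<phi> = 0"
      using assms(6) L \<phi> by (simp add: form_eq_def distr_eq_def zero_form_def)
    moreover have "dbar_form (hat_form_of \<omega>) L \<phi> = weak_dbar v L \<phi>"
      unfolding hat using L \<phi>
      by (intro dbar_form_form_of distr test_fun_dbar_fun) auto
    ultimately show "weak_dbar v L \<phi> = 0" by simp
  qed
  moreover have "1 \<le> q" "q < CARD('n)" using assms(1,2) by auto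
  moreover have "reg_form r \<rho>0 q v" using v0 by (simp add: reg_form_def)
  ultimately obtain \<beta> \<rho>' where \<beta>: "\<rho>' < 1" "reg_form r \<rho>' (q - 1) \<beta>"
    "\<forall>I \<phi>. card I = q \<longrightarrow> test_fun \<phi> \<longrightarrow> weak_dbar \<beta> I \<phi> = pairing (v I) \<phi>"
    \<comment> \<open>With \<open>{}\<close> as the set of eliminated variables the vanishing
      condition is vacuous.\<close>
    using dbar_solvable[of r q \<rho>0 v "{}"] assms(3) \<rho>0 by blast
  have "form_eq q (dbar_form (form_of \<beta>)) (hat_form_of \<omega>)"
    unfolding form_eq_def distr_eq_def
  proof (intro allI impI)
    fix I :: "'n set" and \<phi> :: "complex ^ 'n::{finite,linorder} \<Rightarrow> complex"
    assume I: "card I = q" and \<phi>: "test_fun \<phi>"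
    have "dbar_form (form_of \<beta>) I \<phi> = weak_dbar \<beta> I \<phi>"
    proof (rule dbar_form_form_of)
      fix i assume "i \<in> I"
      then have "card (I - {i}) = q - 1" using I by simp
      from reg_LpD(1)[OF reg_formD[OF \<beta>(2) this]]
      show "distr_of (\<beta> (I - {i})) (dbar_fun i \<phi>) = pairing (\<beta> (I - {i})) (dbar_fun i \<phi>)"
        by (intro distr_of_eq_pairing test_fun_dbar_fun \<phi>) (auto intro: measurable_completion)
    qed
    also have "\<dots> = hat_form_of \<omega> I \<phi>"
      using \<beta>(3) I \<phi> distr[OF I \<phi>] by (simp add: hat_form_of_def)
    finally show "dbar_form (form_of \<beta>) I \<phi> = hat_form_of \<omega> I \<phi>" .
  qed
  then show ?thesis using reg_Lp_imp_Lspace_c[OF reg_formD[OF \<beta>(2)] \<beta>(1)] by blast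
qed

end
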